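(* Let $a>2$. Suppose the regularity assumption holds with constant $L>0$, the local Hölderian error bound holds with constants $c>0$, $\theta\in(0,1/2]$, $R_H>0$, and the $(\sigma,R_S)$ length-normalized directional scaling condition holds with $\sigma,R_S>0$. Put $\bar R:=\min\{R_H,R_S\}$ and $E:=\{x\in\mathcal X: r(x)\ge\bar R\}$. If $E\neq\varnothing$, put $\delta_{\bar R}:=\min_{x\in E}h(x)$ (which is positive) and let $S\ge1$ be any integer with $$\frac{a^2LD^2}{2(S+a-1)}<\delta_{\bar R};$$ if $E=\varnothing$, let $S=1$. Then RFW-OL($a$) either terminates at an optimizer or satisfies $$h_k=O\left(k^{-1/(1-\theta)}\right).$$ More precisely, for every $k\ge S$, $$h_k\leq\max\left\{\left(\frac{\eta_{k-2}}{\eta_{S-1}}\right)^{1/(1-\theta)}h_S,\ \left(\eta_{k-2}\frac{acLD}{2(a-2)\sigma}\right)^{1/(1-\theta)}+\frac{LD^2}{2}\eta_{k-2}^2\right\},$$ where $\eta_j=a/(j+a)$ for integer indices $j\ge-1$.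
   Context: Setting. $\mathcal M$ is a connected, complete, finite-dimensional Riemannian manifold with distance $d$, tangent spaces $T_x\mathcal M$, inner products $\langle\cdot,\cdot\rangle_x$, norms $\|\cdot\|_x$ and exponential map $\operatorname{Exp}_x$. The set $\mathcal X\subset\mathcal M$ is nonempty and compact, with diameter $D:=\sup_{x,y\in\mathcal X}d(x,y)>0$, and is weakly minimizing-geodesically convex: for all $x,y\in\mathcal X$ there is at least one distance-minimizing geodesic from $x$ to $y$ whose image is contained in $\mathcal X$. For $x\in\mathcal X$ the set of feasible minimizing initial velocities is $$\mathcal V(x):=\{v\in T_x\mathcal M:\ \operatorname{Exp}_x(v)\in\mathcal X,\ \|v\|_x=d(x,\operatorname{Exp}_x(v)),\ \operatorname{Exp}_x(tv)\in\mathcal X\ \text{for all }t\in[0,1]\}.$$ The function $f$ is real-valued and differentiable on an open neighborhood of $\mathcal X$, with Riemannian gradient $\operatorname{grad}f$. Put $f^\star:=\min_{\mathcal X}f$, $\mathcal X^\star:=\arg\min_{\mathcal X}f$ (its elements are called optimizers), $h(x):=f(x)-f^\star$, and $r(x):=d(x,\mathcal X^\star)=\min_{y\in\mathcal X^\star}d(x,y)$. Regularity assumption (constant $L>0$): for all $x\in\mathcal X$, $v\in\mathcal V(x)$, $t\in[0,1]$, $f(\operatorname{Exp}_x(tv))\le(1-t)f(x)+tf(\operatorname{Exp}_x(v))$ and $f(\operatorname{Exp}_x(tv))\le f(x)+t\langle\operatorname{grad}f(x),v\rangle_x+\frac L2t^2\|v\|_x^2$. Oracle. $\mathcal S(x):=\arg\min_{v\in\mathcal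 V(x)}\langle\operatorname{grad}f(x),v\rangle_x$ (nonempty and compact), $\bar\ell(x):=\max_{v\in\mathcal S(x)}\|v\|_x$, and $g(x):=-\min_{v\in\mathcal V(x)}\langle\operatorname{grad}f(x),v\rangle_x$ (the Frank–Wolfe gap). Local Hölderian error bound ($c,\theta,R_H$): $r(x)\le c\,h(x)^\theta$ for all $x\in\mathcal X$ with $r(x)\le R_H$. $(\sigma,R_S)$ length-normalized directional scaling: for every $x\in\mathcal X\setminus\mathcal X^\star$ with $r(x)\le R_S$, $\ g(x)/\bar\ell(x)\ge\sigma\,h(x)/r(x)$. Algorithm RFW-OL($a$). Start from an arbitrary $x_0\in\mathcal X$. For $k=0,1,2,\dots$: choose any $v_k\in\mathcal S(x_k)$, set $g_k:=-\langle\operatorname{grad}f(x_k),v_k\rangle_{x_k}$; if $g_k=0$, terminate and return $x_k$; otherwise set $\eta_k:=a/(k+a)$ and $x_{k+1}:=\operatorname{Exp}_{x_k}(\eta_kv_k)$. Write $h_k:=h(x_k)$. Asymptotic statements refer to the case where the algorithm does not terminate, and bounds indexed by $k$ refer to generated iterates. *)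

theory Defs
  imports "HOL-Analysis.Analysis" "HOL-Library.Extended_Nat" "HOL-Library.Landau_Symbols"
begin

section \<open>Riemannian manifolds\<close>

text \<open>\<open>Ck_on k f S\<close> is meant for open \<open>S\<close>: all iterated directional derivatives of \<open>f\<close>
  up to order \<open>k\<close> exist and are continuous on \<open>S\<close>.\<close>

fun Ck_on :: "nat \<Rightarrow> ('a::euclidean_space \<Rightarrow> 'b::real_normed_vector) \<Rightarrow> 'a set \<Rightarrow> bool" where
  "Ck_on 0 f S \<longleftrightarrow> continuous_on S f"
| "Ck_on (Suc k) f S \<longleftrightarrow>
     (\<forall>y\<in>S. f differentiable (at y)) \<and> (\<forall>v. Ck_on k (\<lambda>y. frechet_derivative f (at y) v) S)"

definition smooth_on :: "('a::euclidean_space \<Rightarrow> 'b::real_normed_vector) \<Rightarrow> 'a set \<Rightarrow> bool" where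
  "smooth_on f S \<longleftrightarrow> (\<forall>k. Ck_on k f S)"

text \<open>A chart is a pair of its domain and its coordinate map; the values of the coordinate map
  outside the domain are irrelevant.\<close>

type_synonym ('m, 'n) chart = "'m set \<times> ('m \<Rightarrow> real ^ 'n)"

definition chart_inv :: "('m, 'n::finite) chart \<Rightarrow> real ^ 'n \<Rightarrow> 'm" where
  "chart_inv c = inv_into (fst c) (snd c)"

text \<open>The metric tensor is given by its Gram matrix \<open>(g\<^sub>i\<^sub>j)\<close> in each chart of the atlas, as a
  function of the coordinates.\<close>

record ('m, 'n::finite) riem =
  atlas :: "('m, 'n) chart set"
  gram :: "('m, 'n) chart \<Rightarrow> real ^ 'n \<Rightarrow> real ^ 'n ^ 'n"

definition transition :: "('m, 'n::finite) chart \<Rightarrow> ('m, 'n) chart \<Rightarrow> real ^ 'n \<Rightarrow> real ^ 'n" where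
  "transition c c' = snd c' \<circ> chart_inv c"

definition smooth_atlas :: "('m::topological_space, 'n::finite) riem \<Rightarrow> bool" where
  "smooth_atlas M \<longleftrightarrow>
     (\<Union>c\<in>atlas M. fst c) = UNIV \<and>
     (\<forall>c\<in>atlas M. open (fst c) \<and> open (snd c ` fst c) \<and>
        homeomorphism (fst c) (snd c ` fst c) (snd c) (chart_inv c)) \<and>
     (\<forall>c\<in>atlas M. \<forall>c'\<in>atlas M. smooth_on (transition c c') (snd c ` (fst c \<inter> fst c')))"

definition smooth_metric :: "('m, 'n::finite) riem \<Rightarrow> bool" where
  "smooth_metric M \<longleftrightarrow>
     (\<forall>c\<in>atlas M. smooth_on (gram M c) (snd c ` fst c) \<and>
        (\<forall>y\<in>snd c ` fst c. transpose (gram M c y) = gram M c y \<and>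
           (\<forall>u. u \<noteq> 0 \<longrightarrow> u \<bullet> (gram M c y *v u) > 0))) \<and>
     (\<forall>c\<in>atlas M. \<forall>c'\<in>atlas M. \<forall>p\<in>fst c \<inter> fst c'. \<forall>u w.
        (let J = frechet_derivative (transition c c') (at (snd c p)) in
         u \<bullet> (gram M c (snd c p) *v w) = J u \<bullet> (gram M c' (snd c' p) *v J w)))"

text \<open>Tangent vectors at \<open>x\<close> are represented by their components in one fixed chart
  \<open>chart_at M x\<close> around \<open>x\<close>, so that every tangent space is (identified with) \<open>real ^ 'n\<close>; the inner
  product, norm, gradient and exponential map below all refer to this identification.\<close>

definition chart_at :: "('m, 'n::finite) riem \<Rightarrow> 'm \<Rightarrow> ('m, 'n) chart" where
  "chart_at M x = (SOME c. c \<in> atlas M \<and> x \<in> fst c)"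

definition tinner :: "('m, 'n::finite) riem \<Rightarrow> 'm \<Rightarrow> real ^ 'n \<Rightarrow> real ^ 'n \<Rightarrow> real" where
  "tinner M x u w = u \<bullet> (gram M (chart_at M x) (snd (chart_at M x) x) *v w)"

definition tnorm :: "('m, 'n::finite) riem \<Rightarrow> 'm \<Rightarrow> real ^ 'n \<Rightarrow> real" where
  "tnorm M x u = sqrt (tinner M x u u)"

definition velocity :: "('m, 'n::finite) riem \<Rightarrow> real set \<Rightarrow> (real \<Rightarrow> 'm) \<Rightarrow> real \<Rightarrow> real ^ 'n" where
  "velocity M I \<gamma> t = vector_derivative (snd (chart_at M (\<gamma> t)) \<circ> \<gamma>) (at t within I)"

text \<open>Derivatives at the endpoints of the closed interval \<open>I\<close> are one-sided.\<close>

definition C1_curve_on :: "('m::topological_space, 'n::finite) riem \<Rightarrow> real set \<Rightarrow> (real \<Rightarrow> 'm) \<Rightarrow> bool" where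
  "C1_curve_on M I \<gamma> \<longleftrightarrow> continuous_on I \<gamma> \<and>
     (\<forall>c\<in>atlas M. \<forall>t\<in>I. \<gamma> t \<in> fst c \<longrightarrow>
        (snd c \<circ> \<gamma>) differentiable (at t within I) \<and>
        continuous (at t within I) (\<lambda>s. vector_derivative (snd c \<circ> \<gamma>) (at s within I)))"

definition pw_C1_curve :: "('m::topological_space, 'n::finite) riem \<Rightarrow> (real \<Rightarrow> 'm) \<Rightarrow> bool" where
  "pw_C1_curve M \<gamma> \<longleftrightarrow>
     (\<exists>(m::nat) \<tau>. \<tau> 0 = 0 \<and> \<tau> m = 1 \<and>
        (\<forall>i<m. \<tau> i < \<tau> (Suc i) \<and> C1_curve_on M {\<tau> i..\<tau> (Suc i)} \<gamma>))"

text \<open>For a piecewise \<open>C\<^sup>1\<close> curve the finitely many break points do not influence the integral.\<close>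

definition curve_length :: "('m, 'n::finite) riem \<Rightarrow> (real \<Rightarrow> 'm) \<Rightarrow> real" where
  "curve_length M \<gamma> = integral {0..1} (\<lambda>t. tnorm M (\<gamma> t) (velocity M {0..1} \<gamma> t))"

definition riem_dist :: "('m::topological_space, 'n::finite) riem \<Rightarrow> 'm \<Rightarrow> 'm \<Rightarrow> real" where
  "riem_dist M x y = Inf {curve_length M \<gamma> | \<gamma>. pw_C1_curve M \<gamma> \<and> \<gamma> 0 = x \<and> \<gamma> 1 = y}"

text \<open>Connected complete Riemannian manifold of dimension \<open>CARD('n)\<close>. The points form a metric
  space whose \<open>dist\<close> is required to be the Riemannian distance. Since the Riemannian distance of a
  connected Riemannian manifold is a metric that induces the manifold topology, this is no
  restriction; conversely, Hausdorffness and second countability of the manifold follow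
  (a connected metrizable locally Euclidean space is second countable). Completeness is that of
  the metric space.\<close>

definition complete_riemannian_manifold :: "('m::metric_space, 'n::finite) riem \<Rightarrow> bool" where
  "complete_riemannian_manifold M \<longleftrightarrow>
     smooth_atlas M \<and> smooth_metric M \<and>
     connected (UNIV :: 'm set) \<and>
     (\<forall>x y. dist x y = riem_dist M x y) \<and>
     complete (UNIV :: 'm set)"

section \<open>Geodesics, exponential map, gradient\<close>

text \<open>\<open>gram_deriv M c y i j l\<close> is \<open>\<partial>\<^sub>i g\<^sub>j\<^sub>l\<close> and \<open>christoffel M c y k i j\<close> is
  \<open>\<Gamma>\<^sup>k\<^sub>i\<^sub>j = 1/2 (\<Sum>l. g\<^sup>k\<^sup>l (\<partial>\<^sub>i g\<^sub>j\<^sub>l + \<partial>\<^sub>j g\<^sub>i\<^sub>l - \<partial>\<^sub>l g\<^sub>i\<^sub>j))\<close>,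
  in the coordinates \<open>y\<close> of the chart \<open>c\<close>.\<close>

definition gram_deriv ::
  "('m, 'n::finite) riem \<Rightarrow> ('m, 'n) chart \<Rightarrow> real ^ 'n \<Rightarrow> 'n \<Rightarrow> 'n \<Rightarrow> 'n \<Rightarrow> real" where
  "gram_deriv M c y i j l = frechet_derivative (\<lambda>z. gram M c z $ j $ l) (at y) (axis i 1)"

definition christoffel ::
  "('m, 'n::finite) riem \<Rightarrow> ('m, 'n) chart \<Rightarrow> real ^ 'n \<Rightarrow> 'n \<Rightarrow> 'n \<Rightarrow> 'n \<Rightarrow> real" where
  "christoffel M c y k i j =
     (1/2) * (\<Sum>l\<in>UNIV. matrix_inv (gram M c y) $ k $ l *
        (gram_deriv M c y i j l + gram_deriv M c y j i l - gram_deriv M c y l i j))"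

definition geodesic_on :: "('m::topological_space, 'n::finite) riem \<Rightarrow> real set \<Rightarrow> (real \<Rightarrow> 'm) \<Rightarrow> bool" where
  "geodesic_on M I \<gamma> \<longleftrightarrow> continuous_on I \<gamma> \<and>
     (\<forall>c\<in>atlas M. \<forall>t\<in>I. \<gamma> t \<in> fst c \<longrightarrow>
        (let u = (\<lambda>s. vector_derivative (snd c \<circ> \<gamma>) (at s within I)) in
         (snd c \<circ> \<gamma>) differentiable (at t within I) \<and>
         (u has_vector_derivative
            (\<chi> k. - (\<Sum>i\<in>UNIV. \<Sum>j\<in>UNIV. christoffel M c (snd c (\<gamma> t)) k i j * u t $ i * u t $ j)))
           (at t within I)))"

text \<open>Existence of the geodesic below for all \<open>x\<close> and \<open>v\<close> is the Hopf-Rinow theorem.\<close>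

definition Exp :: "('m::topological_space, 'n::finite) riem \<Rightarrow> 'm \<Rightarrow> real ^ 'n \<Rightarrow> 'm" where
  "Exp M x v = (THE p. \<exists>\<gamma>. geodesic_on M {0..1} \<gamma> \<and> \<gamma> 0 = x \<and>
                   velocity M {0..1} \<gamma> 0 = v \<and> \<gamma> 1 = p)"

definition mdifferentiable_on :: "('m, 'n::finite) riem \<Rightarrow> ('m \<Rightarrow> real) \<Rightarrow> 'm set \<Rightarrow> bool" where
  "mdifferentiable_on M f W \<longleftrightarrow>
     (\<forall>p\<in>W. \<forall>c\<in>atlas M. p \<in> fst c \<longrightarrow> (f \<circ> chart_inv c) differentiable (at (snd c p)))"

definition mdifferential :: "('m, 'n::finite) riem \<Rightarrow> ('m \<Rightarrow> real) \<Rightarrow> 'm \<Rightarrow> real ^ 'n \<Rightarrow> real" where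
  "mdifferential M f x =
     frechet_derivative (f \<circ> chart_inv (chart_at M x)) (at (snd (chart_at M x) x))"

definition grad :: "('m, 'n::finite) riem \<Rightarrow> ('m \<Rightarrow> real) \<Rightarrow> 'm \<Rightarrow> real ^ 'n" where
  "grad M f x = (THE w. \<forall>u. tinner M x w u = mdifferential M f x u)"

section \<open>The optimization problem\<close>

definition weakly_geodesically_convex :: "('m::metric_space, 'n::finite) riem \<Rightarrow> 'm set \<Rightarrow> bool" where
  "weakly_geodesically_convex M X \<longleftrightarrow>
     (\<forall>x\<in>X. \<forall>y\<in>X. \<exists>\<gamma>. geodesic_on M {0..1} \<gamma> \<and> \<gamma> 0 = x \<and> \<gamma> 1 = y \<and>
        curve_length M \<gamma> = dist x y \<and> \<gamma> ` {0..1} \<subseteq> X)"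

definition feasible_velocities :: "('m::metric_space, 'n::finite) riem \<Rightarrow> 'm set \<Rightarrow> 'm \<Rightarrow> (real ^ 'n) set" where
  "feasible_velocities M X x =
     {v. Exp M x v \<in> X \<and> tnorm M x v = dist x (Exp M x v) \<and>
         (\<forall>t\<in>{0..1}. Exp M x (t *\<^sub>R v) \<in> X)}"

definition min_value :: "'m set \<Rightarrow> ('m \<Rightarrow> real) \<Rightarrow> real" where
  "min_value X f = (INF x\<in>X. f x)"

definition optimizers :: "'m set \<Rightarrow> ('m \<Rightarrow> real) \<Rightarrow> 'm set" where
  "optimizers X f = {x \<in> X. \<forall>y\<in>X. f x \<le> f y}"

definition subopt :: "'m set \<Rightarrow> ('m \<Rightarrow> real) \<Rightarrow> 'm \<Rightarrow> real" where
  "subopt X f x = f x - min_value X f"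

definition dist_opt :: "'m::metric_space set \<Rightarrow> ('m \<Rightarrow> real) \<Rightarrow> 'm \<Rightarrow> real" where
  "dist_opt X f x = infdist x (optimizers X f)"

definition regularity :: "('m::metric_space, 'n::finite) riem \<Rightarrow> 'm set \<Rightarrow> ('m \<Rightarrow> real) \<Rightarrow> real \<Rightarrow> bool" where
  "regularity M X f L \<longleftrightarrow>
     (\<forall>x\<in>X. \<forall>v\<in>feasible_velocities M X x. \<forall>t\<in>{0..1}.
        f (Exp M x (t *\<^sub>R v)) \<le> (1 - t) * f x + t * f (Exp M x v) \<and>
        f (Exp M x (t *\<^sub>R v)) \<le> f x + t * tinner M x (grad M f x) v + L / 2 * t\<^sup>2 * (tnorm M x v)\<^sup>2)"

definition oracle_set :: "('m::metric_space, 'n::finite) riem \<Rightarrow> 'm set \<Rightarrow> ('m \<Rightarrow> real) \<Rightarrow> 'm \<Rightarrow> (real ^ 'n) set" where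
  "oracle_set M X f x =
     {v \<in> feasible_velocities M X x.
        \<forall>w\<in>feasible_velocities M X x. tinner M x (grad M f x) v \<le> tinner M x (grad M f x) w}"

text \<open>The extrema in \<open>max_step_length\<close>, \<open>fw_gap\<close> and \<open>min_value\<close> are attained in the intended
  setting, so \<open>SUP\<close> and \<open>INF\<close> are maxima and minima.\<close>

definition max_step_length :: "('m::metric_space, 'n::finite) riem \<Rightarrow> 'm set \<Rightarrow> ('m \<Rightarrow> real) \<Rightarrow> 'm \<Rightarrow> real" where
  "max_step_length M X f x = (SUP v\<in>oracle_set M X f x. tnorm M x v)"

definition fw_gap :: "('m::metric_space, 'n::finite) riem \<Rightarrow> 'm set \<Rightarrow> ('m \<Rightarrow> real) \<Rightarrow> 'm \<Rightarrow> real" where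
  "fw_gap M X f x = - (INF v\<in>feasible_velocities M X x. tinner M x (grad M f x) v)"

definition hoelder_error_bound :: "'m::metric_space set \<Rightarrow> ('m \<Rightarrow> real) \<Rightarrow> real \<Rightarrow> real \<Rightarrow> real \<Rightarrow> bool" where
  "hoelder_error_bound X f c \<theta> R \<longleftrightarrow>
     (\<forall>x\<in>X. dist_opt X f x \<le> R \<longrightarrow> dist_opt X f x \<le> c * subopt X f x powr \<theta>)"

definition directional_scaling ::
  "('m::metric_space, 'n::finite) riem \<Rightarrow> 'm set \<Rightarrow> ('m \<Rightarrow> real) \<Rightarrow> real \<Rightarrow> real \<Rightarrow> bool" where
  "directional_scaling M X f \<sigma> R \<longleftrightarrow>
     (\<forall>x\<in>X - optimizers X f. dist_opt X f x \<le> R \<longrightarrow>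
        fw_gap M X f x / max_step_length M X f x \<ge> \<sigma> * subopt X f x / dist_opt X f x)"

definition open_loop_step :: "real \<Rightarrow> int \<Rightarrow> real" where
  "open_loop_step a j = a / (real_of_int j + a)"

text \<open>\<open>x\<close>, \<open>v\<close> form a run whose generated iterates are the \<open>x k\<close> with \<open>enat k \<le> N\<close>: the run
  terminates and returns \<open>x k\<close> if \<open>N = enat k\<close>, and does not terminate if \<open>N = \<infinity>\<close>.\<close>

definition rfw_ol_run ::
  "('m::metric_space, 'n::finite) riem \<Rightarrow> 'm set \<Rightarrow> ('m \<Rightarrow> real) \<Rightarrow> real \<Rightarrow>
     (nat \<Rightarrow> 'm) \<Rightarrow> (nat \<Rightarrow> real ^ 'n) \<Rightarrow> enat \<Rightarrow> bool" where
  "rfw_ol_run M X f a x v N \<longleftrightarrow>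
     x 0 \<in> X \<and>
     (\<forall>k. enat k \<le> N \<longrightarrow>
        v k \<in> oracle_set M X f (x k) \<and>
        (let g = - tinner M (x k) (grad M f (x k)) (v k) in
         (g = 0 \<longleftrightarrow> N = enat k) \<and>
         (g \<noteq> 0 \<longrightarrow> x (Suc k) = Exp M (x k) (open_loop_step a (int k) *\<^sub>R v k))))"

end

theory Submission
  imports Defs
begin

text \<open>Along the iterates \<open>h\<^sub>k\<^sub>+\<^sub>1 \<le> h\<^sub>k - \<eta>\<^sub>k g\<^sub>k + L \<eta>\<^sub>k\<^sup>2 \<ell>\<^sub>k\<^sup>2 / 2\<close>, and convexity along a minimizing
  geodesic towards an optimizer gives \<open>g\<^sub>k \<ge> h\<^sub>k\<close>. This alone yields \<open>h\<^sub>k = O(1 / k)\<close>, so that from index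
  \<open>S\<close> on the iterates stay where the error bound and the scaling condition hold, which together give
  \<open>g\<^sub>k \<ge> \<sigma> \<ell>\<^sub>k h\<^sub>k\<^bsup>1-\<theta>\<^esup> / c\<close>. Weighting the two lower bounds by \<open>2 / a\<close> and \<open>1 - 2 / a\<close>, either
  \<open>h\<^sub>k\<^bsup>1-\<theta>\<^esup>\<close> is below a multiple of \<open>\<eta>\<^sub>k\<close> or \<open>h\<close> contracts by \<open>1 - 2 / (k + a) = \<eta>\<^sub>k / \<eta>\<^sub>k\<^sub>-\<^sub>2\<close>.

  The inequality \<open>g\<^sub>k \<ge> h\<^sub>k\<close> is the only place where geometry enters: the initial velocity of the
  geodesic has to be a feasible velocity. Since \<open>Exp\<close> is a definite description, this requires
  uniqueness of geodesics (by a Gronwall estimate in charts) but not their existence, and it requires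
  that geodesics have constant speed.\<close>

section \<open>Open-loop recursions\<close>

text \<open>The product of two consecutive steps in the second term telescopes under multiplication by
  the contraction factor \<open>1 - 2 / (k + a) = \<eta>\<^sub>k / \<eta>\<^sub>k\<^sub>-\<^sub>2\<close>.\<close>

lemma open_loop_recursion:
  fixes h :: "nat \<Rightarrow> real" and a \<theta> A B :: real
  defines "p \<equiv> 1 / (1 - \<theta>)"
  assumes a: "a > 2" and \<theta>: "0 < \<theta>" "\<theta> \<le> 1/2" and AB: "A > 0" "B \<ge> 0" and S: "S \<ge> 1" "S \<le> k"
    and nonneg: "\<And>j. S \<le> j \<Longrightarrow> j \<le> k \<Longrightarrow> h j \<ge> 0"
    and contract: "\<And>j. S \<le> j \<Longrightarrow> j < k \<Longrightarrow> A * open_loop_step a (int j) \<le> h j powr (1 - \<theta>) \<Longrightarrow>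
      h (Suc j) \<le> (1 - 2 / (real j + a)) * h j"
    and increase: "\<And>j. S \<le> j \<Longrightarrow> j < k \<Longrightarrow> h (Suc j) \<le> h j + B * (open_loop_step a (int j))\<^sup>2"
  shows "h k \<le> max ((open_loop_step a (int k - 1) / open_loop_step a (int S - 1)) powr p * h S)
    ((open_loop_step a (int k - 1) * A) powr p
      + B * (open_loop_step a (int k - 1) * open_loop_step a (int k - 2)))"
  using S(2) nonneg contract increase
proof (induction k rule: dec_induct)
  case base
  have "open_loop_step a (int S - 1) > 0" using S a by (auto simp: open_loop_step_def)
  then show ?case by simp
next
  case (step j)
  let ?e = "\<lambda>i. open_loop_step a i"
  have j1: "real j \<ge> 1" using S step by linarith
  have pos: "?e (int j) > 0" "?e (int j - 1) > 0" "?e (int j - 2) > 0" "?e (int S - 1) > 0"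
    using S j1 a by (auto simp: open_loop_step_def)
  have p: "1 \<le> p" "p \<le> 2" using \<theta> by (auto simp: p_def field_simps)
  have hj: "h j \<ge> 0" "h (Suc j) \<ge> 0" using step by auto
  have mono: "?e (int j) \<le> ?e (int j - 1)"
    using a j1 by (auto simp: open_loop_step_def intro!: divide_left_mono mult_pos_pos)
  have IH: "h j \<le> max ((?e (int j - 1) / ?e (int S - 1)) powr p * h S)
      ((?e (int j - 1) * A) powr p + B * (?e (int j - 1) * ?e (int j - 2)))"
    using step by auto
  show ?case
  proof (cases "A * ?e (int j) \<le> h j powr (1 - \<theta>)")
    case True
    \<comment> \<open>The product of steps in the second term shrinks exactly by \<open>q\<close>,
      but both powers shrink only by \<open>r powr p\<close>, so \<open>q\<close> must not exceed
      it. The chain is \<open>q \<le> r\<^sup>2 \<le> r powr p\<close>; its last part uses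
      \<open>r \<le> 1\<close> and \<open>p \<le> 2\<close>, the form in which \<theta> \<le> 1/2
      enters.\<close>
    define q where "q = 1 - 2 / (real j + a)"
    define r where "r = ?e (int j) / ?e (int j - 1)"
    have q: "q \<ge> 0" "q = ?e (int j) / ?e (int j - 2)"
      using a j1 by (auto simp: q_def open_loop_step_def diff_divide_distrib[symmetric] divide_simps)
    have r: "0 < r" "r \<le> 1" using pos mono by (auto simp: r_def)
    have "q \<le> r\<^sup>2"
    proof -
      have r_eq: "r = 1 - 1 / (real j + a)" 
        using a j1 by (simp add: r_def open_loop_step_def divide_simps)
      show ?thesis unfolding r_eq q_def by (simp add: power2_diff)
    qed
    also have "\<dots> = r powr 2" using r by simp
    also have "\<dots> \<le> r powr p" using r p by (intro powr_mono') auto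
    finally have qr: "q \<le> r powr p" .
    have "h (Suc j) \<le> q * h j" using step True by (auto simp: q_def)
    also have "\<dots> \<le> q * max ((?e (int j - 1) / ?e (int S - 1)) powr p * h S)
      ((?e (int j - 1) * A) powr p + B * (?e (int j - 1) * ?e (int j - 2)))"
      using IH q by (intro mult_left_mono) auto
    also have "\<dots> = max (q * ((?e (int j - 1) / ?e (int S - 1)) powr p * h S))
      (q * ((?e (int j - 1) * A) powr p + B * (?e (int j - 1) * ?e (int j - 2))))"
      using q(1) by (simp only: max_mult_distrib_left if_True)
    also have "\<dots> \<le> max (r powr p * ((?e (int j - 1) / ?e (int S - 1)) powr p * h S))
      (r powr p * (?e (int j - 1) * A) powr p + B * (?e (int j) * ?e (int j - 1)))"
    proof (intro max.mono)
      show "q * ((?e (int j - 1) / ?e (int S - 1)) powr p * h S)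
        \<le> r powr p * ((?e (int j - 1) / ?e (int S - 1)) powr p * h S)"
        using qr step by (intro mult_right_mono) auto
      have "q * (B * (?e (int j - 1) * ?e (int j - 2))) = B * (?e (int j) * ?e (int j - 1))"
        using pos by (simp add: q(2))
      then show "q * ((?e (int j - 1) * A) powr p + B * (?e (int j - 1) * ?e (int j - 2)))
        \<le> r powr p * (?e (int j - 1) * A) powr p + B * (?e (int j) * ?e (int j - 1))"
        using mult_right_mono[OF qr, of "(?e (int j - 1) * A) powr p"] by (simp only: distrib_left) simp
    qed
    also have "r powr p * ((?e (int j - 1) / ?e (int S - 1)) powr p * h S)
      = (?e (int j) / ?e (int S - 1)) powr p * h S"
      using pos by (simp add: r_def flip: powr_mult mult.assoc)
    also have "r powr p * (?e (int j - 1) * A) powr p = (?e (int j) * A) powr p"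
      using pos AB by (simp add: r_def flip: powr_mult)
    finally show ?thesis by (simp add: add.commute)
  next
    case False
    \<comment> \<open>Below the threshold \<open>h j\<close> is itself bounded, by inverting the
      power. One step then adds at most \<open>B\<close> times the squared step, which the product
      of steps absorbs because the steps decrease.\<close>
    have "h j = (h j powr (1 - \<theta>)) powr p" using hj \<theta> by (simp add: p_def powr_powr)
    also have "\<dots> \<le> (?e (int j) * A) powr p"
      using False p by (intro powr_mono2) (auto simp: mult.commute)
    finally have "h (Suc j) \<le> (?e (int j) * A) powr p + B * (?e (int j))\<^sup>2" using step by fastforce
    also have "B * (?e (int j))\<^sup>2 \<le> B * (?e (int j) * ?e (int j - 1))"
      unfolding power2_eq_square using mono pos AB by (intro mult_left_mono) auto
    finally show ?thesis by (simp add: add.commute)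
  qed
qed

text \<open>The first step is \<open>a / (0 + a) = 1\<close>, so the starting value drops out and
  \<open>B\<close> bounds \<open>h 1\<close>. With \<open>B = L * D\<^sup>2 / 2\<close> the bound at
  \<open>k = S\<close> is the quantity that the condition on \<open>S\<close> compares with
  \<delta>.\<close>

lemma open_loop_sublinear:
  fixes h :: "nat \<Rightarrow> real"
  assumes a: "a > 2" and B: "B \<ge> 0" and k: "1 \<le> k"
    and step: "\<And>j. j < k \<Longrightarrow>
      h (Suc j) \<le> (1 - open_loop_step a (int j)) * h j + B * (open_loop_step a (int j))\<^sup>2"
  shows "h k \<le> a\<^sup>2 * B / (real k + a - 1)"
  using k step
proof (induction k rule: dec_induct)
  case base
  have "h 1 \<le> B" using base[of 0] a by (simp add: open_loop_step_def)
  also have "\<dots> \<le> a * B" using a B mult_right_mono[of 1 a B] by simp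
  finally show ?case using a by (simp add: power2_eq_square)
next
  case (step j)
  define t where "t = real j"
  have t: "t \<ge> 1" using step by (simp add: t_def)
  have "h (Suc j) \<le> (1 - a / (t + a)) * h j + B * (a / (t + a))\<^sup>2"
    using step by (simp add: t_def open_loop_step_def)
  also have "\<dots> \<le> (1 - a / (t + a)) * (a\<^sup>2 * B / (t + a - 1)) + B * (a / (t + a))\<^sup>2"
    using step t a by (intro add_right_mono mult_left_mono) (auto simp: t_def)
  also have "\<dots> = a\<^sup>2 * B / (t + a) * (t / (t + a - 1) + 1 / (t + a))"
    using t a by (simp add: divide_simps power2_eq_square) (simp add: algebra_simps)
  also have "\<dots> \<le> a\<^sup>2 * B / (t + a) * 1"
  proof (intro mult_left_mono)
    \<comment> \<open>The two sides of the next inequality differ by this product plus 1.\<close>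
    have "0 \<le> (a - 2) * (t + a)" using t a by simp
    then have "t + a - 1 \<le> (a - 1) * (t + a)" using a t by (simp add: algebra_simps)
    then have "1 / (t + a) \<le> (a - 1) / (t + a - 1)" using a t by (simp add: field_simps)
    also have "\<dots> = 1 - t / (t + a - 1)" using a t by (simp add: field_simps)
    finally show "t / (t + a - 1) + 1 / (t + a) \<le> 1" by simp
  qed (use B t a in auto)
  finally show ?case by (simp add: t_def)
qed

section \<open>Smooth functions and Lipschitz estimates\<close>

lemma smooth_on_frechet_derivative:
  "smooth_on f S \<Longrightarrow> smooth_on (\<lambda>y. frechet_derivative f (at y) v) S"
  unfolding smooth_on_def by (metis Ck_on.simps(2))

lemma smooth_on_imp_differentiable: "smooth_on f S \<Longrightarrow> y \<in> S \<Longrightarrow> f differentiable (at y)"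
  unfolding smooth_on_def by (metis Ck_on.simps(2))

lemma smooth_on_imp_continuous_on: "smooth_on f S \<Longrightarrow> continuous_on S f"
  unfolding smooth_on_def by (metis Ck_on.simps(1))

text \<open>\<open>smooth_on\<close> provides continuity of the derivative one direction at a time.
  Compactness bounds it in each basis direction, the sum of these bounds dominates the operator
  norm, and convexity allows the mean value inequality.\<close>

lemma smooth_on_imp_lipschitz:
  fixes f :: "'a::euclidean_space \<Rightarrow> 'b::real_normed_vector"
  assumes f: "smooth_on f S" and K: "K \<subseteq> S" "compact K" "convex K"
  shows "\<exists>C. C-lipschitz_on K f"
proof -
  define D where "D = (\<lambda>y. frechet_derivative f (at y))"
  have deriv: "(f has_derivative D y) (at y)" if "y \<in> K" for y
    using smooth_on_imp_differentiable[OF f] that K(1) frechet_derivative_works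
    unfolding D_def by blast
  have "\<exists>m. \<forall>y\<in>K. norm (D y b) \<le> m" for b
  proof -
    have "continuous_on K (\<lambda>y. D y b)"
      using smooth_on_imp_continuous_on[OF smooth_on_frechet_derivative[OF f]] K(1)
      unfolding D_def by (rule continuous_on_subset)
    then have "bounded ((\<lambda>y. D y b) ` K)"
      using K(2) compact_continuous_image compact_imp_bounded by blast
    then show ?thesis by (auto simp: bounded_iff)
  qed
  then obtain m where m: "\<And>b y. y \<in> K \<Longrightarrow> norm (D y b) \<le> m b" by metis
  define C where "C = (\<Sum>b\<in>Basis. \<bar>m b\<bar>)"
  have C: "C \<ge> 0" by (simp add: C_def sum_nonneg)
  have on: "onorm (D y) \<le> C" if y: "y \<in> K" for y
  proof (rule onorm_le)
    fix v
    interpret bounded_linear "D y" using deriv[OF y] has_derivative_bounded_linear by blast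
    have "D y v = D y (\<Sum>b\<in>Basis. (v \<bullet> b) *\<^sub>R b)" by (simp add: euclidean_representation)
    also have "\<dots> = (\<Sum>b\<in>Basis. (v \<bullet> b) *\<^sub>R D y b)" by (simp add: sum scaleR)
    also have "norm \<dots> \<le> (\<Sum>b\<in>Basis. norm v * \<bar>m b\<bar>)"
    proof (rule sum_norm_le)
      fix b :: 'a assume "b \<in> Basis"
      then have "\<bar>v \<bullet> b\<bar> \<le> norm v" by (rule Basis_le_norm)
      then show "norm ((v \<bullet> b) *\<^sub>R D y b) \<le> norm v * \<bar>m b\<bar>"
        using m[OF y, of b] by (auto intro!: mult_mono)
    qed
    finally show "norm (D y v) \<le> C * norm v" by (simp add: C_def sum_distrib_left mult.commute)
  qed
  have "norm (f x - f y) \<le> C * norm (x - y)" if "x \<in> K" "y \<in> K" for x y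
    using differentiable_bound[of K f D C x y] K(3) on that deriv has_derivative_at_withinI by blast
  then have "C-lipschitz_on K f" using C by (intro lipschitz_onI) (auto simp: dist_norm)
  then show ?thesis ..
qed

text \<open>The constants stay existentially quantified here and in the next two lemmas so that the
  rules chain by \<open>intro\<close> in \<open>geodesic_force_lipschitz\<close>. Compactness
  supplies the bounds on the two factors.\<close>

lemma lipschitz_on_mult:
  fixes f g :: "'a::metric_space \<Rightarrow> real"
  assumes "compact K" "\<exists>C. C-lipschitz_on K f" "\<exists>C. C-lipschitz_on K g"
  shows "\<exists>C. C-lipschitz_on K (\<lambda>x. f x * g x)"
proof -
  obtain C1 C2 where C: "C1-lipschitz_on K f" "C2-lipschitz_on K g" using assms by blast
  have "bounded (f ` K)" "bounded (g ` K)"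
    using C assms(1) lipschitz_on_continuous_on compact_continuous_image compact_imp_bounded by blast+
  then obtain M1 M2 where M: "\<And>x. x \<in> K \<Longrightarrow> \<bar>f x\<bar> \<le> M1" "\<And>x. x \<in> K \<Longrightarrow> \<bar>g x\<bar> \<le> M2"
    unfolding bounded_iff by auto
  have "\<bar>f x * g x - f y * g y\<bar> \<le> (\<bar>M2\<bar> * C1 + \<bar>M1\<bar> * C2) * dist x y" if xy: "x \<in> K" "y \<in> K" for x y
  proof -
    have "f x * g x - f y * g y = g x * (f x - f y) + f y * (g x - g y)" by (simp add: algebra_simps)
    also have "\<bar>\<dots>\<bar> \<le> \<bar>g x\<bar> * \<bar>f x - f y\<bar> + \<bar>f y\<bar> * \<bar>g x - g y\<bar>"
      by (metis abs_mult abs_triangle_ineq)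
    also have "\<dots> \<le> \<bar>M2\<bar> * (C1 * dist x y) + \<bar>M1\<bar> * (C2 * dist x y)"
      using M[OF xy(1)] M[OF xy(2)] lipschitz_onD[OF C(1) xy] lipschitz_onD[OF C(2) xy]
      by (intro add_mono mult_mono) (auto simp: dist_real_def)
    finally show ?thesis by (simp add: algebra_simps)
  qed
  then have "(\<bar>M2\<bar> * C1 + \<bar>M1\<bar> * C2)-lipschitz_on K (\<lambda>x. f x * g x)"
    using lipschitz_on_nonneg[OF C(1)] lipschitz_on_nonneg[OF C(2)]
    by (intro lipschitz_onI) (auto simp: dist_real_def)
  then show ?thesis ..
qed

lemma lipschitz_on_sum:
  fixes f :: "'i \<Rightarrow> 'a::metric_space \<Rightarrow> 'b::real_normed_vector"
  assumes "finite I" "\<And>i. i \<in> I \<Longrightarrow> \<exists>C. C-lipschitz_on K (f i)"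
  shows "\<exists>C. C-lipschitz_on K (\<lambda>x. \<Sum>i\<in>I. f i x)"
  using assms
proof (induction I rule: finite_induct)
  case empty
  then show ?case using lipschitz_on_constant by fastforce
next
  case (insert i I)
  then obtain C1 C2 where "C1-lipschitz_on K (f i)" "C2-lipschitz_on K (\<lambda>x. \<Sum>i\<in>I. f i x)" by blast
  from lipschitz_on_add[OF this] show ?case using insert by auto
qed

lemma lipschitz_on_vec_lambda:
  fixes f :: "'n::finite \<Rightarrow> 'a::metric_space \<Rightarrow> real"
  assumes "\<And>i. \<exists>C. C-lipschitz_on K (f i)"
  shows "\<exists>C. C-lipschitz_on K (\<lambda>x. \<chi> i. f i x)"
proof -
  from assms obtain C where C: "\<And>i. (C i)-lipschitz_on K (f i)" by metis
  have "dist (\<chi> i. f i x) (\<chi> i. f i y) \<le> (\<Sum>i\<in>UNIV. C i) * dist x y" if xy: "x \<in> K" "y \<in> K" for x y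
  proof -
    have "dist (\<chi> i. f i x) (\<chi> i. f i y) \<le> (\<Sum>i\<in>UNIV. \<bar>((\<chi> i. f i x) - (\<chi> i. f i y)) $ i\<bar>)"
      unfolding dist_norm by (rule norm_le_l1_cart)
    also have "\<dots> \<le> (\<Sum>i\<in>UNIV. C i * dist x y)"
      using lipschitz_onD[OF C xy] by (intro sum_mono) (simp add: dist_real_def)
    finally show ?thesis by (simp add: sum_distrib_right)
  qed
  moreover have "0 \<le> (\<Sum>i\<in>UNIV. C i)" using C lipschitz_on_nonneg by (intro sum_nonneg) blast
  ultimately show ?thesis by (intro exI lipschitz_onI)
qed

text \<open>Gronwall: weighted by \<open>exp (- (2 * C * s))\<close>, the squared distance of the
  two solutions is nonincreasing, and it starts at 0.\<close>

lemma lipschitz_ode_unique: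
  fixes w1 w2 :: "real \<Rightarrow> 'a::real_inner"
  assumes F: "C-lipschitz_on K F"
    and w1: "\<And>s. s \<in> {a..b} \<Longrightarrow> (w1 has_vector_derivative F (w1 s)) (at s within {a..b})"
    and w2: "\<And>s. s \<in> {a..b} \<Longrightarrow> (w2 has_vector_derivative F (w2 s)) (at s within {a..b})"
    and K: "\<And>s. s \<in> {a..b} \<Longrightarrow> w1 s \<in> K" "\<And>s. s \<in> {a..b} \<Longrightarrow> w2 s \<in> K"
    and init: "w1 a = w2 a" and t: "t \<in> {a..b}"
  shows "w1 t = w2 t"
proof -
  define q where "q = (\<lambda>s. exp (- (2 * C * s)) * ((w1 s - w2 s) \<bullet> (w1 s - w2 s)))"
  have "q t \<le> q a"
  proof (rule DERIV_nonpos_imp_decreasing_open[of a t q])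
    show "a \<le> t" using t by simp
    have "continuous_on {a..b} w1" "continuous_on {a..b} w2"
      unfolding continuous_on_eq_continuous_within using w1 w2
      by (blast intro: has_vector_derivative_continuous)+
    then show "continuous_on {a..t} q"
      unfolding q_def using t by (intro continuous_intros) (auto elim: continuous_on_subset)
  next
    fix s assume s: "a < s" "s < t"
    have at: "at s within {a..b} = at s" using s t by (intro at_within_interior) auto
    let ?d = "w1 s - w2 s" and ?F = "F (w1 s) - F (w2 s)"
    have "((\<lambda>s. w1 s - w2 s) has_vector_derivative ?F) (at s)"
      using w1[of s] w2[of s] s t unfolding at by (auto intro: has_vector_derivative_diff)
    note D = this[unfolded has_vector_derivative_def]
    have "((\<lambda>s. (w1 s - w2 s) \<bullet> (w1 s - w2 s)) has_real_derivative (2 * (?d \<bullet> ?F))) (at s)"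
      unfolding has_field_derivative_def
      by (rule has_derivative_eq_rhs[OF has_derivative_inner[OF D D]])
         (simp add: fun_eq_iff inner_commute)
    then have "(q has_real_derivative
        - (2 * C) * exp (- (2 * C * s)) * (?d \<bullet> ?d) + 2 * (?d \<bullet> ?F) * exp (- (2 * C * s))) (at s)"
      unfolding q_def by (auto intro!: derivative_eq_intros)
    moreover have "?d \<bullet> ?F \<le> C * (?d \<bullet> ?d)"
    proof -
      have "?d \<bullet> ?F \<le> norm ?d * norm ?F" by (rule norm_cauchy_schwarz)
      also have "\<dots> \<le> norm ?d * (C * norm ?d)"
        using lipschitz_on_normD[OF F K(1) K(2)] s t by (intro mult_left_mono) auto
      finally show ?thesis by (simp add: dot_square_norm power2_eq_square mult_ac)
    qed
    then have "- (2 * C) * exp (- (2 * C * s)) * (?d \<bullet> ?d) + 2 * (?d \<bullet> ?F) * exp (- (2 * C * s)) \<le> 0"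
      using mult_left_mono[of "?d \<bullet> ?F" "C * (?d \<bullet> ?d)" "2 * exp (- (2 * C * s))"]
      by (simp add: algebra_simps)
    ultimately show "\<exists>y. (q has_real_derivative y) (at s) \<and> y \<le> 0" by blast
  qed
  then have "exp (- (2 * C * t)) * (norm (w1 t - w2 t))\<^sup>2 \<le> 0"
    by (simp add: q_def init dot_square_norm)
  then show ?thesis by (simp add: mult_le_0_iff)
qed

section \<open>The geodesic equation in a chart\<close>

lemma norm_matrix_vector_le:
  fixes A :: "real ^ 'n ^ 'm"
  shows "norm (A *v u) \<le> real CARD('m) * norm A * norm u"
proof -
  have "norm (A *v u) \<le> (\<Sum>i\<in>UNIV. \<bar>(A *v u) $ i\<bar>)" by (rule norm_le_l1_cart)
  also have "\<dots> \<le> (\<Sum>i\<in>(UNIV :: 'm set). norm A * norm u)"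
  proof (rule sum_mono)
    fix i
    have "\<bar>(A *v u) $ i\<bar> \<le> norm (A $ i) * norm u"
      unfolding matrix_vector_mul_component by (rule Cauchy_Schwarz_ineq2)
    also have "\<dots> \<le> norm A * norm u" by (intro mult_right_mono Finite_Cartesian_Product.norm_nth_le) auto
    finally show "\<bar>(A *v u) $ i\<bar> \<le> norm A * norm u" .
  qed
  finally show ?thesis by simp
qed

lemma bounded_bilinear_matrix_vector_mult:
  "bounded_bilinear ((*v) :: real ^ 'n ^ 'm \<Rightarrow> real ^ 'n \<Rightarrow> real ^ 'm)"
proof
  show "\<exists>K. \<forall>(A :: real ^ 'n ^ 'm) u. norm (A *v u) \<le> norm A * norm u * K"
    using norm_matrix_vector_le by (metis mult.commute mult.left_commute)
qed (simp_all add: matrix_vector_mult_add_rdistrib matrix_vector_right_distrib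
  matrix_vector_mult_scaleR scaleR_matrix_vector_assoc)

lemma matrix_inv_right_posdef:
  fixes A :: "real ^ 'n ^ 'n"
  assumes "\<And>u. u \<noteq> 0 \<Longrightarrow> u \<bullet> (A *v u) > 0"
  shows "A ** matrix_inv A = mat 1"
proof -
  have "\<forall>u. A *v u = 0 \<longrightarrow> u = 0" using assms by (metis inner_zero_right less_irrefl)
  then have "invertible A" by (metis matrix_left_invertible_ker invertible_left_inverse)
  then show ?thesis unfolding matrix_inv_def invertible_def by (metis (mono_tags, lifting) someI_ex)
qed

text \<open>The geodesic equation \<open>u' = geodesic_acc\<close> with its index lowered reads
  \<open>G u' = - geodesic_force\<close>. This form avoids estimating the derivative of the inverse of the
  Gram matrix \<open>G\<close>.\<close>

definition geodesic_force :: "('m, 'n::finite) riem \<Rightarrow> ('m, 'n) chart \<Rightarrow> real ^ 'n \<Rightarrow> real ^ 'n \<Rightarrow> real ^ 'n" where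
  "geodesic_force M c y u = (\<chi> l. (1/2) * (\<Sum>i\<in>UNIV. \<Sum>j\<in>UNIV.
     (gram_deriv M c y i j l + gram_deriv M c y j i l - gram_deriv M c y l i j) * u $ i * u $ j))"

definition geodesic_acc :: "('m, 'n::finite) riem \<Rightarrow> ('m, 'n) chart \<Rightarrow> real ^ 'n \<Rightarrow> real ^ 'n \<Rightarrow> real ^ 'n" where
  "geodesic_acc M c y u =
     (\<chi> k. - (\<Sum>i\<in>UNIV. \<Sum>j\<in>UNIV. christoffel M c y k i j * u $ i * u $ j))"

text \<open>Moving the sum over \<open>l\<close> inside \<open>christoffel\<close> to the outside
  exposes a product with the inverse Gram matrix.\<close>

lemma geodesic_acc_eq: "geodesic_acc M c y u = - (matrix_inv (gram M c y) *v geodesic_force M c y u)"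
proof -
  have "(\<Sum>i\<in>UNIV. \<Sum>j\<in>UNIV. christoffel M c y k i j * u $ i * u $ j)
    = (\<Sum>l\<in>UNIV. matrix_inv (gram M c y) $ k $ l * geodesic_force M c y u $ l)" for k
  proof -
    let ?t = "\<lambda>i j l. matrix_inv (gram M c y) $ k $ l * ((1/2) *
      ((gram_deriv M c y i j l + gram_deriv M c y j i l - gram_deriv M c y l i j) * u $ i * u $ j))"
    have "(\<Sum>i\<in>UNIV. \<Sum>j\<in>UNIV. christoffel M c y k i j * u $ i * u $ j)
      = (\<Sum>i\<in>UNIV. \<Sum>j\<in>UNIV. \<Sum>l\<in>UNIV. ?t i j l)"
      unfolding christoffel_def sum_distrib_left sum_distrib_right
      by (intro sum.cong refl) (simp add: mult_ac)
    also have "\<dots> = (\<Sum>i\<in>UNIV. \<Sum>l\<in>UNIV. \<Sum>j\<in>UNIV. ?t i j l)"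
      by (intro sum.cong refl sum.swap)
    also have "\<dots> = (\<Sum>l\<in>UNIV. \<Sum>i\<in>UNIV. \<Sum>j\<in>UNIV. ?t i j l)" by (rule sum.swap)
    finally show ?thesis by (simp add: geodesic_force_def sum_distrib_left)
  qed
  then show ?thesis
    by (simp add: vec_eq_iff geodesic_acc_def matrix_vector_mult_def)
qed

context
  fixes M :: "('m, 'n::finite) riem" and c :: "('m, 'n) chart"
  assumes metric: "smooth_metric M" and c: "c \<in> atlas M"
begin

lemma smooth_gram: "smooth_on (gram M c) (snd c ` fst c)"
  using metric c by (auto simp: smooth_metric_def)

lemma gram_pos: "y \<in> snd c ` fst c \<Longrightarrow> u \<noteq> 0 \<Longrightarrow> u \<bullet> (gram M c y *v u) > 0"
  using metric c by (auto simp: smooth_metric_def)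

lemma gram_sym: "y \<in> snd c ` fst c \<Longrightarrow> u \<bullet> (gram M c y *v w) = w \<bullet> (gram M c y *v u)"
  using metric c unfolding smooth_metric_def by (metis dot_lmul_matrix inner_commute vector_transpose_matrix)

lemma gram_has_derivative:
  "y \<in> snd c ` fst c \<Longrightarrow> (gram M c has_derivative frechet_derivative (gram M c) (at y)) (at y)"
  using smooth_on_imp_differentiable[OF smooth_gram] frechet_derivative_works by blast

lemma gram_geodesic_acc:
  assumes "y \<in> snd c ` fst c"
  shows "gram M c y *v geodesic_acc M c y u = - geodesic_force M c y u"
proof -
  have "gram M c y ** matrix_inv (gram M c y) = mat 1"
    using gram_pos assms by (intro matrix_inv_right_posdef) auto
  then show ?thesis
    unfolding geodesic_acc_eq by (simp add: matrix_vector_mul_assoc linear_neg[OF matrix_vector_mul_linear])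
qed

text \<open>\<open>gram_deriv\<close> differentiates single entries, whereas smoothness is given for
  the matrix-valued map; this passes between the two.\<close>

lemma gram_deriv_eq:
  assumes "y \<in> snd c ` fst c"
  shows "gram_deriv M c y i j l = frechet_derivative (gram M c) (at y) (axis i 1) $ j $ l"
proof -
  have "((\<lambda>z. gram M c z $ j $ l) has_derivative (\<lambda>h. frechet_derivative (gram M c) (at y) h $ j $ l)) (at y)"
    using gram_has_derivative[OF assms]
    by (intro bounded_linear.has_derivative[OF bounded_linear_vec_nth])
  then show ?thesis unfolding gram_deriv_def by (metis frechet_derivative_at)
qed

lemma frechet_derivative_gram:
  assumes "y \<in> snd c ` fst c"
  shows "frechet_derivative (gram M c) (at y) h $ j $ l = (\<Sum>i\<in>UNIV. h $ i * gram_deriv M c y i j l)"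
proof -
  interpret bounded_linear "frechet_derivative (gram M c) (at y)"
    using gram_has_derivative[OF assms] has_derivative_bounded_linear by blast
  have "frechet_derivative (gram M c) (at y) h
    = frechet_derivative (gram M c) (at y) (\<Sum>i\<in>UNIV. h $ i *\<^sub>R axis i 1)"
    by (simp add: basis_expansion scalar_mult_eq_scaleR[symmetric])
  also have "\<dots> = (\<Sum>i\<in>UNIV. h $ i *\<^sub>R frechet_derivative (gram M c) (at y) (axis i 1))"
    by (simp add: sum scaleR)
  finally show ?thesis by (simp add: gram_deriv_eq[OF assms])
qed

text \<open>The force is quadratic in the velocity with first derivatives of the Gram matrix as
  coefficients. These are smooth, hence Lipschitz on the ball, and finite sums of products preserve
  this on a compact set.\<close>

lemma geodesic_force_lipschitz:
  assumes sub: "cball y e \<subseteq> snd c ` fst c"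
  shows "\<exists>C. C-lipschitz_on (cball y e \<times> cball u r) (\<lambda>p. geodesic_force M c (fst p) (snd p))"
proof -
  let ?K = "cball y e \<times> cball u r"
  have K: "compact ?K" by (simp add: compact_Times)
  have snd: "\<exists>C. C-lipschitz_on ?K (\<lambda>p. snd p $ i)" for i
    by (intro exI[of _ 1] lipschitz_onI)
       (metis dist_snd_le dist_vec_nth_le order_trans mult_1, simp)
  have gd: "\<exists>C. C-lipschitz_on ?K (\<lambda>p. gram_deriv M c (fst p) i j l)" for i j l
  proof -
    obtain C where C: "C-lipschitz_on (cball y e) (\<lambda>y. frechet_derivative (gram M c) (at y) (axis i 1))"
      using smooth_on_imp_lipschitz[OF smooth_on_frechet_derivative[OF smooth_gram] sub] by auto
    have "dist (gram_deriv M c (fst p) i j l) (gram_deriv M c (fst q) i j l) \<le> C * dist p q"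
      if pq: "p \<in> ?K" "q \<in> ?K" for p q
    proof -
      have mem: "fst p \<in> cball y e" "fst q \<in> cball y e" using pq by (auto simp: mem_Times_iff)
      let ?G = "\<lambda>p. frechet_derivative (gram M c) (at (fst p)) (axis i 1)"
      have "dist (?G p $ j $ l) (?G q $ j $ l) \<le> dist (?G p) (?G q)"
        by (meson dist_vec_nth_le order_trans)
      also have "\<dots> \<le> C * dist (fst p) (fst q)" using lipschitz_onD[OF C mem] .
      also have "\<dots> \<le> C * dist p q"
        using lipschitz_on_nonneg[OF C] by (intro mult_left_mono dist_fst_le)
      finally show ?thesis using mem sub by (simp add: gram_deriv_eq subset_iff)
    qed
    then show ?thesis using lipschitz_on_nonneg[OF C] by (intro exI lipschitz_onI)
  qed
  have "\<exists>C. C-lipschitz_on ?K (\<lambda>p. gram_deriv M c (fst p) i j l + gram_deriv M c (fst p) j i l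
      - gram_deriv M c (fst p) l i j)" for i j l
  proof -
    obtain C1 C2 C3 where "C1-lipschitz_on ?K (\<lambda>p. gram_deriv M c (fst p) i j l)"
      "C2-lipschitz_on ?K (\<lambda>p. gram_deriv M c (fst p) j i l)"
      "C3-lipschitz_on ?K (\<lambda>p. gram_deriv M c (fst p) l i j)"
      using gd by metis
    from lipschitz_on_diff[OF lipschitz_on_add[OF this(1,2)] this(3)] show ?thesis by blast
  qed
  moreover have "\<exists>C. C-lipschitz_on ?K (\<lambda>p. 1/2 :: real)" using lipschitz_on_constant by blast
  ultimately show ?thesis
    unfolding geodesic_force_def
    by (intro lipschitz_on_vec_lambda lipschitz_on_mult lipschitz_on_sum K snd finite)
qed

text \<open>The quadratic form attains a positive minimum over the compact product of the ball with
  the unit sphere; homogeneity extends the estimate from unit vectors to all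
  \<open>u\<close>.\<close>

lemma gram_coercive:
  assumes sub: "cball y e \<subseteq> snd c ` fst c" and e: "e \<ge> 0"
  shows "\<exists>m>0. \<forall>z\<in>cball y e. \<forall>u. m * (norm u)\<^sup>2 \<le> u \<bullet> (gram M c z *v u)"
proof -
  let ?K = "cball y e \<times> sphere (0 :: real ^ 'n) 1"
  let ?q = "\<lambda>p. snd p \<bullet> (gram M c (fst p) *v snd p)"
  have "continuous_on ?K (\<lambda>p. gram M c (fst p))"
    using smooth_on_imp_continuous_on[OF smooth_gram] sub
    by (intro continuous_on_compose2[of "snd c ` fst c" "gram M c" ?K fst] continuous_intros) auto
  then have cont: "continuous_on ?K ?q"
    unfolding matrix_vector_mult_def by (intro continuous_intros)
  \<comment> \<open>Any unit vector will do: it shows that the domain of the minimization is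
    nonempty.\<close>
  have "axis undefined 1 \<in> sphere (0 :: real ^ 'n) 1" by (simp add: norm_axis_1)
  then have "?K \<noteq> {}" using e by (metis SigmaI cball_eq_empty equals0I ex_in_conv linorder_not_le)
  then obtain p where p: "p \<in> ?K" "\<And>q. q \<in> ?K \<Longrightarrow> ?q p \<le> ?q q"
    using continuous_attains_inf[of ?K ?q] cont by (auto simp: compact_Times)
  have "snd p \<noteq> 0" "fst p \<in> snd c ` fst c" using p(1) sub by auto
  then have "?q p > 0" using gram_pos by blast
  moreover have "?q p * (norm u)\<^sup>2 \<le> u \<bullet> (gram M c z *v u)" if z: "z \<in> cball y e" for z u
  proof (cases "u = 0")
    case False
    then have "(z, u /\<^sub>R norm u) \<in> ?K" using z by simp
    then have "?q p \<le> (u /\<^sub>R norm u) \<bullet> (gram M c z *v (u /\<^sub>R norm u))" using p(2) by fastforce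
    also have "\<dots> = (u \<bullet> (gram M c z *v u)) / (norm u)\<^sup>2"
      by (simp add: matrix_vector_mult_scaleR power2_eq_square divide_simps)
    finally show ?thesis using False by (simp add: field_simps)
  qed simp
  ultimately show ?thesis by blast
qed

lemma geodesic_acc_lipschitz:
  assumes sub: "cball y e \<subseteq> snd c ` fst c" and e: "e \<ge> 0"
  shows "\<exists>C. C-lipschitz_on (cball y e \<times> cball u r) (\<lambda>p. geodesic_acc M c (fst p) (snd p))"
proof -
  let ?K = "cball y e \<times> cball u r"
  let ?f = "\<lambda>p. geodesic_force M c (fst p) (snd p)"
  let ?a = "\<lambda>p. geodesic_acc M c (fst p) (snd p)"
  let ?G = "\<lambda>p. gram M c (fst p)"
  let ?n = "real CARD('n)"
  obtain m where m: "m > 0" "\<And>z w. z \<in> cball y e \<Longrightarrow> m * (norm w)\<^sup>2 \<le> w \<bullet> (gram M c z *v w)"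
    using gram_coercive[OF sub e] by blast
  have coercive: "m * norm w \<le> norm (?G p *v w)" if "p \<in> ?K" for p w
  proof (cases "w = 0")
    case False
    have "m * (norm w)\<^sup>2 \<le> norm w * norm (?G p *v w)"
      using m(2)[of "fst p" w] that norm_cauchy_schwarz[of w "?G p *v w"] by force
    then show ?thesis using False by (simp add: power2_eq_square mult.assoc mult.left_commute)
  qed simp
  have acc: "?G p *v ?a p = - ?f p" if "p \<in> ?K" for p
    using that sub by (intro gram_geodesic_acc) auto
  obtain C1 where C1: "C1-lipschitz_on ?K ?f" using geodesic_force_lipschitz[OF sub] by blast
  obtain C2 where C2: "C2-lipschitz_on (cball y e) (gram M c)"
    using smooth_on_imp_lipschitz[OF smooth_gram sub] by auto
  have "bounded (?f ` ?K)"
    using C1 lipschitz_on_continuous_on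
    by (intro compact_imp_bounded compact_continuous_image compact_Times) auto
  then obtain B where "\<forall>w\<in>?f ` ?K. norm w \<le> B" unfolding bounded_iff ..
  then have B: "\<And>p. p \<in> ?K \<Longrightarrow> norm (?f p) \<le> B" by blast
  have bound: "norm (?a p) \<le> B / m" if p: "p \<in> ?K" for p
    using coercive[OF p, of "?a p"] B[OF p] acc[OF p] m(1) by (simp add: field_simps)
  define C where "C = (C1 + ?n * C2 * (\<bar>B\<bar> / m)) / m"
  have "dist (?a p) (?a q) \<le> C * dist p q" if p: "p \<in> ?K" and q: "q \<in> ?K" for p q
  proof -
    \<comment> \<open>This is the difference of the equations \<open>G a = - f\<close> at
      \<open>p\<close> and \<open>q\<close>, with the change of \<open>G\<close> charged to the
      bounded vector \<open>?a q\<close>. Coercivity at \<open>p\<close> then isolates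
      \<open>?a p - ?a q\<close>.\<close>
    have eq: "?G p *v (?a p - ?a q) = - (?f p - ?f q) - (?G p - ?G q) *v ?a q"
      using acc[OF p] acc[OF q]
      by (simp add: matrix_vector_mult_diff_distrib matrix_vector_mult_diff_rdistrib)
    have "m * norm (?a p - ?a q) \<le> norm (?G p *v (?a p - ?a q))" using coercive[OF p] .
    also have "\<dots> \<le> norm (?f p - ?f q) + norm ((?G p - ?G q) *v ?a q)"
      unfolding eq by (metis norm_minus_cancel norm_triangle_ineq4)
    also have "\<dots> \<le> C1 * dist p q + ?n * (C2 * dist p q) * (\<bar>B\<bar> / m)"
    proof (intro add_mono)
      show "norm (?f p - ?f q) \<le> C1 * dist p q" using lipschitz_onD[OF C1 p q] by (simp add: dist_norm)
      have "norm (?G p - ?G q) \<le> C2 * dist (fst p) (fst q)"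
        using lipschitz_onD[OF C2, of "fst p" "fst q"] p q by (auto simp: dist_norm)
      also have "\<dots> \<le> C2 * dist p q"
        using lipschitz_on_nonneg[OF C2] by (intro mult_left_mono dist_fst_le)
      finally have "norm (?G p - ?G q) \<le> C2 * dist p q" .
      moreover have "norm (?a q) \<le> \<bar>B\<bar> / m"
        using bound[OF q] m(1) by (meson abs_ge_self divide_right_mono less_imp_le order_trans)
      ultimately have "?n * norm (?G p - ?G q) * norm (?a q) \<le> ?n * (C2 * dist p q) * (\<bar>B\<bar> / m)"
        using m(1) lipschitz_on_nonneg[OF C2] by (intro mult_mono) auto
      then show "norm ((?G p - ?G q) *v ?a q) \<le> ?n * (C2 * dist p q) * (\<bar>B\<bar> / m)"
        using norm_matrix_vector_le[of "?G p - ?G q" "?a q"] by linarith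
    qed
    finally show ?thesis using m(1) by (simp add: C_def dist_norm field_simps)
  qed
  moreover have "C \<ge> 0"
    using lipschitz_on_nonneg[OF C1] lipschitz_on_nonneg[OF C2] m(1) by (simp add: C_def)
  ultimately show ?thesis by (intro exI lipschitz_onI)
qed

end

text \<open>Contracted with \<open>u\<close> in all three indices, each of the three derivative
  terms of the force becomes the same sum \<open>T\<close> after renaming indices, so they add up to
  \<open>T + T - T\<close>. The identity makes the squared speed of a geodesic constant.\<close>

lemma geodesic_force_energy:
  assumes "smooth_metric M" "c \<in> atlas M" "y \<in> snd c ` fst c"
  shows "2 * (u \<bullet> geodesic_force M c y u) = u \<bullet> (frechet_derivative (gram M c) (at y) u *v u)"
proof -
  let ?D = "gram_deriv M c y"
  define T where "T = (\<Sum>i\<in>UNIV. \<Sum>j\<in>UNIV. \<Sum>l\<in>UNIV. ?D i j l * u $ i * u $ j * u $ l)"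
  have swap: "(\<Sum>i\<in>UNIV. \<Sum>j\<in>UNIV. \<Sum>l\<in>UNIV. F i j l) = (\<Sum>j\<in>UNIV. \<Sum>l\<in>UNIV. \<Sum>i\<in>UNIV. F i j l)"
    for F :: "'b \<Rightarrow> 'b \<Rightarrow> 'b \<Rightarrow> real"
    by (subst sum.swap) (intro sum.cong refl sum.swap)
  have T1: "(\<Sum>l\<in>UNIV. \<Sum>i\<in>UNIV. \<Sum>j\<in>UNIV. ?D i j l * u $ i * u $ j * u $ l) = T"
    unfolding T_def by (rule swap)
  have T2: "(\<Sum>l\<in>UNIV. \<Sum>i\<in>UNIV. \<Sum>j\<in>UNIV. ?D j i l * u $ i * u $ j * u $ l) = T"
    unfolding T1[symmetric] 
    by (rule sum.cong[OF refl], subst sum.swap) (simp add: mult_ac)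
  have T3: "(\<Sum>l\<in>UNIV. \<Sum>i\<in>UNIV. \<Sum>j\<in>UNIV. ?D l i j * u $ i * u $ j * u $ l) = T"
    unfolding T_def by (intro sum.cong refl) (simp add: mult_ac)
  have "2 * (u \<bullet> geodesic_force M c y u) = (\<Sum>l\<in>UNIV. \<Sum>i\<in>UNIV. \<Sum>j\<in>UNIV.
      ?D i j l * u $ i * u $ j * u $ l + ?D j i l * u $ i * u $ j * u $ l - ?D l i j * u $ i * u $ j * u $ l)"
    by (simp add: inner_vec_def geodesic_force_def sum_distrib_left algebra_simps)
  also have "\<dots> = T" by (simp add: sum.distrib sum_subtractf T1 T2 T3)
  also have "T = (\<Sum>j\<in>UNIV. \<Sum>l\<in>UNIV. \<Sum>i\<in>UNIV. ?D i j l * u $ i * u $ j * u $ l)"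
    unfolding T_def by (rule swap)
  also have "\<dots> = u \<bullet> (frechet_derivative (gram M c) (at y) u *v u)"
    by (simp add: inner_vec_def matrix_vector_mult_def frechet_derivative_gram[OF assms]
        sum_distrib_left sum_distrib_right mult_ac)
  finally show ?thesis .
qed

section \<open>Geodesics\<close>

context
  fixes M :: "('m::metric_space, 'n::finite) riem"
  assumes atlas: "smooth_atlas M"
begin

lemma chart_at: "chart_at M p \<in> atlas M" "p \<in> fst (chart_at M p)"
proof -
  have "\<exists>c. c \<in> atlas M \<and> p \<in> fst c" using atlas unfolding smooth_atlas_def by blast
  from someI_ex[OF this] show "chart_at M p \<in> atlas M" "p \<in> fst (chart_at M p)"
    by (auto simp: chart_at_def)
qed

lemma open_chart: "c \<in> atlas M \<Longrightarrow> open (fst c)" "c \<in> atlas M \<Longrightarrow> open (snd c ` fst c)"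
  using atlas by (auto simp: smooth_atlas_def)

lemma chart_inv_chart: "c \<in> atlas M \<Longrightarrow> p \<in> fst c \<Longrightarrow> chart_inv c (snd c p) = p"
  using atlas by (auto simp: smooth_atlas_def homeomorphism_def)

lemma continuous_on_chart: "c \<in> atlas M \<Longrightarrow> continuous_on (fst c) (snd c)"
  using atlas by (auto simp: smooth_atlas_def homeomorphism_def)

text \<open>Derivatives at \<open>t\<close> depend only on nearby parameters, so identities valid
  while the curve stays in one chart can be differentiated there.\<close>

lemma curve_near_chart:
  assumes "continuous_on I \<gamma>" "t \<in> I" "c \<in> atlas M" "\<gamma> t \<in> fst c"
  shows "\<exists>d>0. \<forall>s\<in>I. dist s t < d \<longrightarrow> \<gamma> s \<in> fst c"
proof -
  obtain e where e: "e > 0" "ball (\<gamma> t) e \<subseteq> fst c"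
    using open_chart(1)[OF assms(3)] assms(4) open_contains_ball by blast
  obtain d where "d > 0" "\<forall>s\<in>I. dist s t < d \<longrightarrow> dist (\<gamma> s) (\<gamma> t) < e"
    using assms(1,2) e(1) unfolding continuous_on_iff by blast
  then show ?thesis using e(2) by (auto simp: subset_iff dist_commute)
qed

lemma geodesic_onD:
  assumes "geodesic_on M I \<gamma>" "c \<in> atlas M" "t \<in> I" "\<gamma> t \<in> fst c"
  defines "u \<equiv> \<lambda>s. vector_derivative (snd c \<circ> \<gamma>) (at s within I)"
  shows "((snd c \<circ> \<gamma>) has_vector_derivative u t) (at t within I)"
    and "(u has_vector_derivative geodesic_acc M c (snd c (\<gamma> t)) (u t)) (at t within I)"
  using assms unfolding geodesic_on_def Let_def geodesic_acc_def by (auto simp: vector_derivative_works)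

lemma geodesic_continuous: "geodesic_on M I \<gamma> \<Longrightarrow> continuous_on I \<gamma>"
  by (simp add: geodesic_on_def)

text \<open>Confines position and velocity to a product of balls of the kind on which
  \<open>geodesic_acc_lipschitz\<close> applies.\<close>

lemma geodesic_near_state:
  assumes \<gamma>: "geodesic_on M I \<gamma>" and c: "c \<in> atlas M" and t: "t \<in> I" "\<gamma> t \<in> fst c" and e: "e > 0"
  defines "u \<equiv> \<lambda>s. vector_derivative (snd c \<circ> \<gamma>) (at s within I)"
  shows "\<exists>d>0. \<forall>s\<in>I. dist s t < d \<longrightarrow>
    \<gamma> s \<in> fst c \<and> snd c (\<gamma> s) \<in> cball (snd c (\<gamma> t)) e \<and> u s \<in> cball (u t) e"
proof -
  note D = geodesic_onD[OF \<gamma> c t, folded u_def]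
  obtain d1 where d1: "d1 > 0" "\<forall>s\<in>I. dist s t < d1 \<longrightarrow> \<gamma> s \<in> fst c"
    using curve_near_chart[OF geodesic_continuous[OF \<gamma>] t(1) c t(2)] by blast
  have "continuous (at t within I) (snd c \<circ> \<gamma>)" "continuous (at t within I) u"
    using D has_vector_derivative_continuous by blast+
  then have "\<exists>d>0. \<forall>s\<in>I. dist s t < d \<longrightarrow> dist (snd c (\<gamma> s)) (snd c (\<gamma> t)) < e"
    "\<exists>d>0. \<forall>s\<in>I. dist s t < d \<longrightarrow> dist (u s) (u t) < e"
    using e unfolding continuous_within_eps_delta o_def by blast+
  then obtain d2 d3 where "d2 > 0" "\<forall>s\<in>I. dist s t < d2 \<longrightarrow> dist (snd c (\<gamma> s)) (snd c (\<gamma> t)) < e"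
    and "d3 > 0" "\<forall>s\<in>I. dist s t < d3 \<longrightarrow> dist (u s) (u t) < e"
    by blast
  then show ?thesis using d1
    by (intro exI[of _ "min d1 (min d2 d3)"]) (auto simp: dist_commute less_imp_le)
qed

text \<open>Chain rule: near \<open>t\<close> the curve in the chart \<open>c'\<close> is the
  transition map applied to the curve in the chart \<open>c\<close>.\<close>

lemma velocity_transition:
  assumes \<gamma>: "continuous_on I \<gamma>" and t: "t \<in> I"
    and c: "c \<in> atlas M" "\<gamma> t \<in> fst c" and c': "c' \<in> atlas M" "\<gamma> t \<in> fst c'"
    and u: "((snd c \<circ> \<gamma>) has_vector_derivative u) (at t within I)"
  shows "((snd c' \<circ> \<gamma>) has_vector_derivative
    frechet_derivative (transition c c') (at (snd c (\<gamma> t))) u) (at t within I)"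
proof -
  have "smooth_on (transition c c') (snd c ` (fst c \<inter> fst c'))"
    using atlas c(1) c'(1) by (auto simp: smooth_atlas_def)
  then have "(transition c c' has_derivative frechet_derivative (transition c c') (at (snd c (\<gamma> t))))
      (at (snd c (\<gamma> t)))"
    using c c' smooth_on_imp_differentiable frechet_derivative_works by blast
  then have D: "((transition c c' \<circ> (snd c \<circ> \<gamma>)) has_vector_derivative
      frechet_derivative (transition c c') (at (snd c (\<gamma> t))) u) (at t within I)"
    by (intro vector_derivative_diff_chain_within[OF u])
       (auto intro: has_derivative_at_withinI)
  obtain d where d: "d > 0" "\<forall>s\<in>I. dist s t < d \<longrightarrow> \<gamma> s \<in> fst c"
    using curve_near_chart[OF \<gamma> t c] by blast
  show ?thesis
    by (rule has_vector_derivative_transform_within[OF D d(1) t])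
       (simp add: transition_def chart_inv_chart[OF c(1)] d(2))
qed

lemma mdifferentiable_continuous_on:
  assumes f: "mdifferentiable_on M f W"
  shows "continuous_on W f"
  unfolding continuous_on_eq_continuous_within
proof
  fix p assume p: "p \<in> W"
  define c where "c = chart_at M p"
  have c: "c \<in> atlas M" "p \<in> fst c" by (auto simp: c_def chart_at)
  have "isCont (snd c) p"
    using continuous_on_chart[OF c(1)] open_chart(1)[OF c(1)] c(2) continuous_on_eq_continuous_at
    by blast
  moreover have "isCont (f \<circ> chart_inv c) (snd c p)"
    using f p c unfolding mdifferentiable_on_def by (blast intro: differentiable_imp_continuous_within)
  ultimately have "isCont ((f \<circ> chart_inv c) \<circ> snd c) p" by (rule isCont_o2[folded o_def])
  moreover have "\<forall>\<^sub>F q in nhds p. ((f \<circ> chart_inv c) \<circ> snd c) q = f q"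
    using open_chart(1)[OF c(1)] c chart_inv_chart[OF c(1)]
    by (auto simp: eventually_nhds)
  ultimately have "isCont f p" using isCont_cong by blast
  then show "continuous (at p within W) f" by (rule continuous_at_imp_continuous_at_within)
qed

section \<open>Uniqueness of geodesics with given initial data\<close>

context
  assumes metric: "smooth_metric M"
begin

text \<open>In one chart the geodesic equation is a first-order system \<open>F\<close> for the pair
  \<open>w\<close> of position and velocity. Both curves start from the same state and stay for a
  short time in a set \<open>K\<close> where \<open>F\<close> is Lipschitz, so
  \<open>lipschitz_ode_unique\<close> applies; equal coordinates in a chart mean equal
  points.\<close>

lemma geodesic_unique_local:
  assumes geo: "geodesic_on M {0..1} \<gamma>1" "geodesic_on M {0..1} \<gamma>2"
    and t: "0 \<le> t" "t < 1" "\<gamma>1 t = \<gamma>2 t" and c: "c \<in> atlas M" "\<gamma>1 t \<in> fst c"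
    and vel: "vector_derivative (snd c \<circ> \<gamma>1) (at t within {0..1})
      = vector_derivative (snd c \<circ> \<gamma>2) (at t within {0..1})"
  shows "\<exists>e>0. t + e \<le> 1 \<and> (\<forall>s\<in>{t..t+e}. \<gamma>1 s = \<gamma>2 s)"
proof -
  define u where "u = (\<lambda>\<gamma> s. vector_derivative (snd c \<circ> \<gamma>) (at s within {0..1::real}))"
  define w where "w = (\<lambda>\<gamma> s. (snd c (\<gamma> s), u \<gamma> s))"
  have tI: "t \<in> {0..1}" using t by simp
  have "snd c (\<gamma>1 t) \<in> snd c ` fst c" using c by blast
  then obtain r where r: "r > 0" "cball (snd c (\<gamma>1 t)) r \<subseteq> snd c ` fst c"
    using open_chart(2)[OF c(1)] open_contains_cball by blast
  define K where "K = cball (snd c (\<gamma>1 t)) r \<times> cball (u \<gamma>1 t) r"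
  define F where "F = (\<lambda>p. (snd p, geodesic_acc M c (fst p) (snd p)))"
  have near: "\<exists>d>0. \<forall>s\<in>{0..1}. dist s t < d \<longrightarrow> \<gamma> s \<in> fst c \<and> w \<gamma> s \<in> K"
    if "\<gamma> \<in> {\<gamma>1, \<gamma>2}" for \<gamma>
  proof -
    have "geodesic_on M {0..1} \<gamma>" "\<gamma> t \<in> fst c" "\<gamma> t = \<gamma>1 t" "u \<gamma> t = u \<gamma>1 t"
      using that geo t c vel by (auto simp: u_def)
    from geodesic_near_state[OF this(1) c(1) tI this(2) r(1)] this(3,4) show ?thesis
      by (simp add: w_def K_def u_def)
  qed
  obtain d1 d2 where d: "d1 > 0" "\<forall>s\<in>{0..1}. dist s t < d1 \<longrightarrow> \<gamma>1 s \<in> fst c \<and> w \<gamma>1 s \<in> K"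
    "d2 > 0" "\<forall>s\<in>{0..1}. dist s t < d2 \<longrightarrow> \<gamma>2 s \<in> fst c \<and> w \<gamma>2 s \<in> K"
    using near[of \<gamma>1] near[of \<gamma>2] by auto
  \<comment> \<open>Halving keeps \<open>e\<close> strictly below both radii, as the closed interval
    \<open>{t..t+e}\<close> requires; \<open>1 - t\<close> keeps that interval inside the
    domain.\<close>
  define e where "e = min (1 - t) (min (d1 / 2) (d2 / 2))"
  have e: "e > 0" "t + e \<le> 1" "e < d1" "e < d2" using d(1,3) t by (auto simp: e_def)
  have sub: "{t..t+e} \<subseteq> {0..1}" using e t by auto
  have in_chart: "\<gamma> s \<in> fst c" "w \<gamma> s \<in> K" if "\<gamma> \<in> {\<gamma>1, \<gamma>2}" "s \<in> {t..t+e}" for \<gamma> s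
  proof -
    have "s \<in> {0..1}" "dist s t \<le> e" using that(2) sub by (auto simp: dist_real_def)
    then show "\<gamma> s \<in> fst c" "w \<gamma> s \<in> K" using d(2,4) e(3,4) that(1) by fastforce+
  qed
  obtain C where "C-lipschitz_on K (\<lambda>p. geodesic_acc M c (fst p) (snd p))"
    using geodesic_acc_lipschitz[OF metric c(1) r(2), of "u \<gamma>1 t" r] r(1) unfolding K_def by auto
  moreover have "1-lipschitz_on K snd" by (intro lipschitz_onI) (auto simp: dist_snd_le)
  ultimately have F: "(sqrt (1\<^sup>2 + C\<^sup>2))-lipschitz_on K F"
    unfolding F_def by (intro lipschitz_on_Pair)
  have ode: "(w \<gamma> has_vector_derivative F (w \<gamma> s)) (at s within {t..t+e})"
    if \<gamma>: "\<gamma> \<in> {\<gamma>1, \<gamma>2}" and s: "s \<in> {t..t+e}" for \<gamma> s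
  proof -
    have "geodesic_on M {0..1} \<gamma>" "s \<in> {0..1}" using geo \<gamma> s sub by auto
    from has_vector_derivative_Pair[OF geodesic_onD[OF this(1) c(1) this(2) in_chart(1)[OF \<gamma> s]]]
    have "(w \<gamma> has_vector_derivative F (w \<gamma> s)) (at s within {0..1})"
      unfolding w_def F_def u_def fst_conv snd_conv by (simp only: o_apply)
    then show ?thesis using sub by (rule has_vector_derivative_within_subset)
  qed
  have init: "w \<gamma>1 t = w \<gamma>2 t" unfolding w_def u_def t(3) vel ..
  have "\<gamma>1 s = \<gamma>2 s" if s: "s \<in> {t..t+e}" for s
  proof -
    have "w \<gamma>1 s = w \<gamma>2 s"
    proof (rule lipschitz_ode_unique[of "sqrt (1\<^sup>2 + C\<^sup>2)" K F t "t + e" "w \<gamma>1" "w \<gamma>2" s])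
      show "(w \<gamma>1 has_vector_derivative F (w \<gamma>1 r)) (at r within {t..t+e})" if "r \<in> {t..t+e}" for r
        by (rule ode[OF _ that]) simp
      show "(w \<gamma>2 has_vector_derivative F (w \<gamma>2 r)) (at r within {t..t+e})" if "r \<in> {t..t+e}" for r
        by (rule ode[OF _ that]) simp
      show "w \<gamma>1 r \<in> K" if "r \<in> {t..t+e}" for r by (rule in_chart(2)[OF _ that]) simp
      show "w \<gamma>2 r \<in> K" if "r \<in> {t..t+e}" for r by (rule in_chart(2)[OF _ that]) simp
    qed (fact F init s)+
    then have "snd c (\<gamma>1 s) = snd c (\<gamma>2 s)" unfolding w_def by (rule Pair_inject)
    moreover have "\<gamma>1 s \<in> fst c" "\<gamma>2 s \<in> fst c" by (rule in_chart(1)[OF _ s], simp)+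
    ultimately show ?thesis by (metis chart_inv_chart[OF c(1)])
  qed
  then show ?thesis using e by blast
qed

text \<open>Continuation: let \<open>T\<close> be the supremum of the times up to which the curves
  agree. Positions and velocities then agree at \<open>T\<close> as well, so if
  \<open>T < 1\<close>, local uniqueness carries the agreement past \<open>T\<close>.\<close>

lemma geodesic_unique:
  assumes geo: "geodesic_on M {0..1} \<gamma>1" "geodesic_on M {0..1} \<gamma>2"
    and init: "\<gamma>1 0 = \<gamma>2 0" "velocity M {0..1} \<gamma>1 0 = velocity M {0..1} \<gamma>2 0"
    and t: "t \<in> {0..1}"
  shows "\<gamma>1 t = \<gamma>2 t"
proof -
  define A where "A = {t \<in> {0..1}. \<forall>s\<in>{0..t}. \<gamma>1 s = \<gamma>2 s}"
  define T where "T = Sup A"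
  have A0: "0 \<in> A" using init by (auto simp: A_def)
  have bdd: "bdd_above A" by (rule bdd_aboveI[of _ 1]) (auto simp: A_def)
  have T: "0 \<le> T" unfolding T_def by (rule cSup_upper[OF A0 bdd])
  moreover have "T \<le> 1" unfolding T_def 
  proof (rule cSup_least)
    show "A \<noteq> {}" using A0 by blast
  qed (simp add: A_def)
  ultimately have T: "0 \<le> T" "T \<le> 1" by auto
  have below: "\<gamma>1 s = \<gamma>2 s" if "s \<in> {0..<T}" for s
  proof -
    have "\<exists>t\<in>A. s < t" using that A0 bdd less_cSup_iff[of A s] by (auto simp: T_def)
    then show ?thesis using that by (auto simp: A_def)
  qed
  have at_T: "\<gamma>1 T = \<gamma>2 T"
  \<comment> \<open>For \<open>T \<noteq> 0\<close> the closure of \<open>{0..<T}\<close> is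
    \<open>{0..T}\<close>, so continuity carries the agreement to \<open>T\<close>; for
    \<open>T = 0\<close> that interval is empty and the initial condition is used.\<close>
  proof (cases "T = 0")
    case False
    then have closure: "closure {0..<T} = {0..T}" using T by simp
    have "continuous_on {0..T} (\<lambda>s. dist (\<gamma>1 s) (\<gamma>2 s))"
      using T by (intro continuous_intros continuous_on_subset[OF geodesic_continuous[OF geo(1)]]
        continuous_on_subset[OF geodesic_continuous[OF geo(2)]]) auto
    then have "dist (\<gamma>1 T) (\<gamma>2 T) = 0"
      using continuous_constant_on_closure[of "{0..<T}" "\<lambda>s. dist (\<gamma>1 s) (\<gamma>2 s)" 0 T] T
      by (simp add: closure below)
    then show ?thesis by simp
  qed (use init in simp)
  have up_to_T: "\<gamma>1 s = \<gamma>2 s" if "s \<in> {0..T}" for s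
    using that below at_T by (cases "s = T") auto
  have "T = 1"
  proof (rule ccontr)
    assume "T \<noteq> 1"
    then have T1: "T < 1" using T by simp
    \<comment> \<open>With this choice of chart the case \<open>T = 0\<close> below is exactly the
      hypothesis on \<open>velocity\<close>.\<close>
    define c where "c = chart_at M (\<gamma>1 T)"
    have c: "c \<in> atlas M" "\<gamma>1 T \<in> fst c" by (auto simp: c_def chart_at)
    have "vector_derivative (snd c \<circ> \<gamma>1) (at T within {0..1})
      = vector_derivative (snd c \<circ> \<gamma>2) (at T within {0..1})"
    proof (cases "T = 0")
      case True
      then show ?thesis using init by (simp add: velocity_def c_def)
    next
      case False
      \<comment> \<open>The curves are known to agree only to the left of \<open>T\<close>. Both are
        differentiable within \<open>{0..1}\<close>, so their derivatives at \<open>T\<close> are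
        already determined by the restrictions to \<open>{0..T}\<close>.\<close>
      have TI: "T \<in> {0..1}" and sub: "{0..T} \<subseteq> {0..1}" using T by auto
      have c2: "\<gamma>2 T \<in> fst c" using c at_T by simp
      note D1 = has_vector_derivative_within_subset[OF geodesic_onD(1)[OF geo(1) c(1) TI c(2)] sub]
      note D2 = has_vector_derivative_within_subset[OF geodesic_onD(1)[OF geo(2) c(1) TI c2] sub]
      have "((snd c \<circ> \<gamma>1) has_vector_derivative
          vector_derivative (snd c \<circ> \<gamma>2) (at T within {0..1})) (at T within {0..T})"
        by (rule has_vector_derivative_transform[OF _ _ D2]) (use T up_to_T in auto)
      then show ?thesis
        using vector_derivative_unique_within_closed_interval[of 0 T T, unfolded box_real, OF _ _ D1]
          T False by simp
    qed
    then obtain e where e: "e > 0" "T + e \<le> 1" "\<forall>s\<in>{T..T+e}. \<gamma>1 s = \<gamma>2 s"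
      using geodesic_unique_local[OF geo T(1) T1 at_T c] by blast
    have "\<gamma>1 s = \<gamma>2 s" if "s \<in> {0..T+e}" for s
      using that e(3) up_to_T by (cases "s \<le> T") auto
    then have "T + e \<in> A" using T e by (simp add: A_def)
    then show False using cSup_upper[OF _ bdd, of "T + e"] e(1) by (simp add: T_def)
  qed
  then show ?thesis using up_to_T t by simp
qed

section \<open>The exponential map along a geodesic\<close>

lemma Exp_geodesic:
  assumes "geodesic_on M {0..1} \<gamma>"
  shows "Exp M (\<gamma> 0) (velocity M {0..1} \<gamma> 0) = \<gamma> 1"
  unfolding Exp_def
proof (rule the_equality)
  fix p
  assume "\<exists>\<beta>. geodesic_on M {0..1} \<beta> \<and> \<beta> 0 = \<gamma> 0 \<and>
    velocity M {0..1} \<beta> 0 = velocity M {0..1} \<gamma> 0 \<and> \<beta> 1 = p"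
  then obtain \<beta> where \<beta>: "geodesic_on M {0..1} \<beta>" "\<beta> 0 = \<gamma> 0"
    "velocity M {0..1} \<beta> 0 = velocity M {0..1} \<gamma> 0" "\<beta> 1 = p" by blast
  show "p = \<gamma> 1" using geodesic_unique[OF \<beta>(1) assms \<beta>(2,3), of 1] \<beta>(4) by simp
qed (use assms in blast)

text \<open>The acceleration is quadratic in the velocity. The scalings are nested because the chain
  rule in \<open>geodesic_rescale\<close> produces them one at a time.\<close>

lemma geodesic_acc_scale: "geodesic_acc M c y (t *\<^sub>R u) = t *\<^sub>R (t *\<^sub>R geodesic_acc M c y u)"
  by (simp add: geodesic_acc_def vec_eq_iff sum_distrib_left mult_ac)

text \<open>Slowing down by \<open>t\<close> multiplies velocity by \<open>t\<close> and
  acceleration by its square, in agreement with the quadratic right-hand side. The case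
  \<open>t = 0\<close>, a constant curve, is included so that all of \<open>{0..1}\<close> is
  covered in \<open>Exp_geodesic_scale\<close>.\<close>

lemma geodesic_rescale:
  assumes \<gamma>: "geodesic_on M {0..1} \<gamma>" and t: "t \<in> {0..1}"
  defines "\<beta> \<equiv> \<lambda>s. \<gamma> (t * s)"
  shows "geodesic_on M {0..1} \<beta>" "velocity M {0..1} \<beta> 0 = t *\<^sub>R velocity M {0..1} \<gamma> 0"
proof -
  have ts: "t * s \<in> {0..1}" if "s \<in> {0..1}" for s
    using that t by (auto intro: mult_le_one)
  have chain: "((\<lambda>s. z (t * s)) has_vector_derivative (t *\<^sub>R z')) (at s within {0..1})"
    if "(z has_vector_derivative z') (at (t * s) within {0..1})" for z :: "real \<Rightarrow> real ^ 'n" and z' s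
  proof -
    have "((*) t has_vector_derivative t) (at s within {0..1})"
      by (auto intro!: derivative_eq_intros simp: has_vector_derivative_def)
    moreover have "(z has_vector_derivative z') (at (t * s) within (*) t ` {0..1})"
      using that ts by (intro has_vector_derivative_within_subset[OF that]) auto
    ultimately show ?thesis using vector_diff_chain_within by (fastforce simp: o_def)
  qed
  have cont: "continuous_on {0..1} \<beta>"
    unfolding \<beta>_def using ts
    by (intro continuous_on_compose2[OF geodesic_continuous[OF \<gamma>]] continuous_intros) auto
  have D: "((snd c \<circ> \<beta>) has_vector_derivative
      t *\<^sub>R vector_derivative (snd c \<circ> \<gamma>) (at (t * s) within {0..1})) (at s within {0..1})"
    if "c \<in> atlas M" "s \<in> {0..1}" "\<beta> s \<in> fst c" for c s
    using chain[OF geodesic_onD(1)[OF \<gamma> that(1) ts[OF that(2)]]] that(3) by (simp add: \<beta>_def o_def)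
  have vd: "vector_derivative (snd c \<circ> \<beta>) (at s within {0..1})
      = t *\<^sub>R vector_derivative (snd c \<circ> \<gamma>) (at (t * s) within {0..1})"
    if "c \<in> atlas M" "s \<in> {0..1}" "\<beta> s \<in> fst c" for c s
    using vector_derivative_within_closed_interval[OF _ that(2) D[OF that]] by simp
  show "geodesic_on M {0..1} \<beta>"
    unfolding geodesic_on_def Let_def geodesic_acc_def[symmetric]
  proof (intro conjI cont ballI impI)
    fix c s assume c: "c \<in> atlas M" and s: "s \<in> {0..1}" and \<beta>s: "\<beta> s \<in> fst c"
    show "(snd c \<circ> \<beta>) differentiable (at s within {0..1})"
      using D[OF c s \<beta>s] by (rule differentiableI_vector)
    obtain d where d: "d > 0" "\<forall>r\<in>{0..1}. dist r s < d \<longrightarrow> \<beta> r \<in> fst c"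
      using curve_near_chart[OF cont s c \<beta>s] by blast
    let ?u = "\<lambda>s. vector_derivative (snd c \<circ> \<gamma>) (at s within {0..1})"
    have "((\<lambda>r. t *\<^sub>R ?u (t * r)) has_vector_derivative
        t *\<^sub>R (t *\<^sub>R geodesic_acc M c (snd c (\<beta> s)) (?u (t * s)))) (at s within {0..1})"
      using geodesic_onD(2)[OF \<gamma> c ts[OF s]] \<beta>s unfolding \<beta>_def
      by (intro bounded_linear.has_vector_derivative[OF bounded_linear_scaleR_right] chain)
    from has_vector_derivative_transform_within[OF this d(1) s] d(2) vd[OF c]
    show "((\<lambda>s. vector_derivative (snd c \<circ> \<beta>) (at s within {0..1})) has_vector_derivative
       geodesic_acc M c (snd c (\<beta> s)) (vector_derivative (snd c \<circ> \<beta>) (at s within {0..1})))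
       (at s within {0..1})"
      using s \<beta>s by (auto simp: geodesic_acc_scale)
  qed
  show "velocity M {0..1} \<beta> 0 = t *\<^sub>R velocity M {0..1} \<gamma> 0"
    unfolding velocity_def using vd[OF chart_at(1), of 0 "\<gamma> 0"] chart_at(2) by (simp add: \<beta>_def)
qed

lemma Exp_geodesic_scale:
  assumes "geodesic_on M {0..1} \<gamma>" "t \<in> {0..1}"
  shows "Exp M (\<gamma> 0) (t *\<^sub>R velocity M {0..1} \<gamma> 0) = \<gamma> t"
  using Exp_geodesic[OF geodesic_rescale(1)[OF assms]] geodesic_rescale(2)[OF assms] by simp

section \<open>Constant speed and length of geodesics\<close>

lemma tinner_velocity:
  assumes \<gamma>: "geodesic_on M {0..1} \<gamma>" and t: "t \<in> {0..1}" and c: "c \<in> atlas M" "\<gamma> t \<in> fst c"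
  defines "u \<equiv> vector_derivative (snd c \<circ> \<gamma>) (at t within {0..1})"
  shows "tinner M (\<gamma> t) (velocity M {0..1} \<gamma> t) (velocity M {0..1} \<gamma> t)
    = u \<bullet> (gram M c (snd c (\<gamma> t)) *v u)"
proof -
  let ?c' = "chart_at M (\<gamma> t)"
  note c' = chart_at[of "\<gamma> t"]
  \<comment> \<open>\<open>velocity\<close> reads every point in its own chart and so need not vary
    continuously. The speed is therefore moved to a fixed chart, where it can be differentiated;
    compatibility of the metric with transitions leaves its value unchanged.\<close>
  have "velocity M {0..1} \<gamma> t = frechet_derivative (transition c ?c') (at (snd c (\<gamma> t))) u"
    unfolding velocity_def u_def
    by (rule vector_derivative_within_closed_interval[OF _ t velocity_transition])
       (use geodesic_continuous[OF \<gamma>] t c c' geodesic_onD[OF \<gamma> c(1) t c(2)] in auto)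
  moreover have "u \<bullet> (gram M c (snd c (\<gamma> t)) *v u) =
    frechet_derivative (transition c ?c') (at (snd c (\<gamma> t))) u \<bullet> (gram M ?c' (snd ?c' (\<gamma> t)) *v
      frechet_derivative (transition c ?c') (at (snd c (\<gamma> t))) u)"
    using metric c c' unfolding smooth_metric_def Let_def by blast
  ultimately show ?thesis by (simp add: tinner_def)
qed

text \<open>In a fixed chart the product rule gives
  \<open>2 (u \<bullet> G a) + u \<bullet> G' u\<close>. Lowering the index in the geodesic equation
  turns the first term into minus twice the product of \<open>u\<close> with the force, which
  \<open>geodesic_force_energy\<close> cancels against the second.\<close>

lemma geodesic_speed_derivative:
  assumes \<gamma>: "geodesic_on M {0..1} \<gamma>" and t: "t \<in> {0..1}"
  shows "((\<lambda>s. tinner M (\<gamma> s) (velocity M {0..1} \<gamma> s) (velocity M {0..1} \<gamma> s)) has_derivative (\<lambda>_. 0))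
    (at t within {0..1})"
proof -
  define c where "c = chart_at M (\<gamma> t)"
  have c: "c \<in> atlas M" "\<gamma> t \<in> fst c" by (auto simp: c_def chart_at)
  define u where "u = (\<lambda>s. vector_derivative (snd c \<circ> \<gamma>) (at s within {0..1}))"
  let ?y = "snd c (\<gamma> t)"
  let ?G = "\<lambda>s. gram M c (snd c (\<gamma> s))"
  let ?G' = "frechet_derivative (gram M c) (at ?y) (u t)"
  let ?a = "geodesic_acc M c ?y (u t)"
  have y: "?y \<in> snd c ` fst c" using c by blast
  have z: "((snd c \<circ> \<gamma>) has_vector_derivative u t) (at t within {0..1})"
    and u: "(u has_vector_derivative ?a) (at t within {0..1})"
    using geodesic_onD[OF \<gamma> c(1) t c(2)] by (simp_all add: u_def)
  have "((gram M c \<circ> (snd c \<circ> \<gamma>)) has_vector_derivative ?G') (at t within {0..1})"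
    by (rule vector_derivative_diff_chain_within[OF z])
       (use gram_has_derivative[OF metric c(1) y] in \<open>auto intro: has_derivative_at_withinI\<close>)
  then have "(?G has_vector_derivative ?G') (at t within {0..1})" by (simp add: o_def)
  from bounded_bilinear.has_vector_derivative[OF bounded_bilinear_matrix_vector_mult this u]
  have "((\<lambda>s. ?G s *v u s) has_vector_derivative (?G t *v ?a + ?G' *v u t)) (at t within {0..1})" .
  from bounded_bilinear.has_vector_derivative[OF bounded_bilinear_inner u this]
  have "((\<lambda>s. u s \<bullet> (?G s *v u s)) has_vector_derivative
      (u t \<bullet> (?G t *v ?a + ?G' *v u t) + ?a \<bullet> (?G t *v u t))) (at t within {0..1})" .
  moreover have "u t \<bullet> (?G t *v ?a + ?G' *v u t) + ?a \<bullet> (?G t *v u t) = 0"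
    using gram_sym[OF metric c(1) y, of ?a "u t"] gram_geodesic_acc[OF metric c(1) y, of "u t"]
      geodesic_force_energy[OF metric c(1) y, of "u t"]
    by (simp add: inner_add_right inner_diff_right)
  ultimately have D: "((\<lambda>s. u s \<bullet> (?G s *v u s)) has_vector_derivative 0) (at t within {0..1})"
    by simp
  obtain d where d: "d > 0" "\<forall>s\<in>{0..1}. dist s t < d \<longrightarrow> \<gamma> s \<in> fst c"
    using curve_near_chart[OF geodesic_continuous[OF \<gamma>] t c] by blast
  have "((\<lambda>s. tinner M (\<gamma> s) (velocity M {0..1} \<gamma> s) (velocity M {0..1} \<gamma> s)) has_vector_derivative 0)
    (at t within {0..1})"
    by (rule has_vector_derivative_transform_within[OF D d(1) t])
       (use d(2) tinner_velocity[OF \<gamma> _ c(1)] in \<open>auto simp: u_def\<close>)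
  then show ?thesis by (simp add: has_vector_derivative_def)
qed

text \<open>The integrand is constant. This converts the condition on the length in
  \<open>weakly_geodesically_convex\<close> into the condition on the norm in
  \<open>feasible_velocities\<close>.\<close>

lemma geodesic_length:
  assumes \<gamma>: "geodesic_on M {0..1} \<gamma>"
  shows "curve_length M \<gamma> = tnorm M (\<gamma> 0) (velocity M {0..1} \<gamma> 0)"
proof -
  let ?e = "\<lambda>s. tinner M (\<gamma> s) (velocity M {0..1} \<gamma> s) (velocity M {0..1} \<gamma> s)"
  obtain k where k: "\<forall>s\<in>{0..1}. ?e s = k"
    using has_derivative_zero_constant[of "{0..1}" ?e] geodesic_speed_derivative[OF \<gamma>] by auto
  have "curve_length M \<gamma> = integral {0..1::real} (\<lambda>_. sqrt k)"
    unfolding curve_length_def using k by (intro integral_cong) (simp add: tnorm_def)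
  then show ?thesis using k by (simp add: tnorm_def)
qed

section \<open>The Frank-Wolfe gap dominates the suboptimality\<close>

lemma tinner_pos: "u \<noteq> 0 \<Longrightarrow> tinner M p u u > 0"
  unfolding tinner_def using gram_pos[OF metric chart_at(1)] chart_at(2) by blast

text \<open>Resolves the definite description in \<open>grad\<close>: the inverse Gram matrix
  applied to the vector \<open>b\<close> of partial derivatives is a representing vector, and
  positive definiteness excludes a second one.\<close>

lemma tinner_grad:
  assumes f: "mdifferentiable_on M f W" and p: "p \<in> W"
  shows "tinner M p (grad M f p) u = mdifferential M f p u"
proof -
  define c where "c = chart_at M p"
  have c: "c \<in> atlas M" "p \<in> fst c" by (auto simp: c_def chart_at)
  define y where "y = snd c p"
  have y: "y \<in> snd c ` fst c" using c by (auto simp: y_def)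
  let ?G = "gram M c y" and ?l = "mdifferential M f p"
  have "((f \<circ> chart_inv c) has_derivative ?l) (at y)"
    using f p c unfolding mdifferentiable_on_def mdifferential_def c_def[symmetric] y_def[symmetric]
    by (metis frechet_derivative_works y_def)
  then interpret l: bounded_linear ?l by (rule has_derivative_bounded_linear)
  define b where "b = (\<chi> i. ?l (axis i 1))"
  have l: "?l u = u \<bullet> b" for u
  proof -
    have "?l u = ?l (\<Sum>i\<in>UNIV. u $ i *\<^sub>R axis i 1)"
      by (simp add: basis_expansion scalar_mult_eq_scaleR[symmetric])
    then show ?thesis by (simp add: l.sum l.scaleR b_def inner_vec_def)
  qed
  have "?G ** matrix_inv ?G = mat 1"
    using gram_pos[OF metric c(1) y] by (rule matrix_inv_right_posdef)
  then have "u \<bullet> (?G *v (matrix_inv ?G *v b)) = ?l u" for u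
    by (simp add: matrix_vector_mul_assoc l)
  then have ex: "\<forall>u. tinner M p (matrix_inv ?G *v b) u = ?l u"
    unfolding tinner_def c_def[symmetric] y_def[symmetric] using gram_sym[OF metric c(1) y] by simp
  have uniq: "w = w'" if "\<forall>u. tinner M p w u = ?l u" "\<forall>u. tinner M p w' u = ?l u" for w w'
  proof (rule ccontr)
    assume "w \<noteq> w'"
    then have "tinner M p (w - w') (w - w') > 0" by (intro tinner_pos) simp
    moreover have "tinner M p (w - w') (w - w') = 0"
      using that by (simp add: tinner_def inner_diff_left)
    ultimately show False by simp
  qed
  have "\<exists>!w. \<forall>u. tinner M p w u = ?l u" using ex uniq by blast
  from theI'[OF this] show ?thesis unfolding grad_def by blast
qed

lemma has_derivative_along_geodesic:
  assumes f: "mdifferentiable_on M f W" and \<gamma>: "geodesic_on M {0..1} \<gamma>" and W: "\<gamma> 0 \<in> W"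
  shows "((\<lambda>t. f (\<gamma> t)) has_real_derivative
    tinner M (\<gamma> 0) (grad M f (\<gamma> 0)) (velocity M {0..1} \<gamma> 0)) (at 0 within {0..1})"
proof -
  define c where "c = chart_at M (\<gamma> 0)"
  have c: "c \<in> atlas M" "\<gamma> 0 \<in> fst c" by (auto simp: c_def chart_at)
  have "(f \<circ> chart_inv c) differentiable (at (snd c (\<gamma> 0)))"
    using f W c unfolding mdifferentiable_on_def by blast
  then have f': "((f \<circ> chart_inv c) has_derivative mdifferential M f (\<gamma> 0)) (at (snd c (\<gamma> 0)))"
    unfolding mdifferential_def c_def[symmetric] by (simp add: frechet_derivative_works)
  have "((snd c \<circ> \<gamma>) has_vector_derivative velocity M {0..1} \<gamma> 0) (at 0 within {0..1})"
    using geodesic_onD(1)[OF \<gamma> c(1) _ c(2)] by (simp add: velocity_def c_def)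
  from vector_derivative_diff_chain_within[OF this, of "f \<circ> chart_inv c"] f'
  have D: "(((f \<circ> chart_inv c) \<circ> (snd c \<circ> \<gamma>)) has_vector_derivative
      mdifferential M f (\<gamma> 0) (velocity M {0..1} \<gamma> 0)) (at 0 within {0..1})"
    by (auto intro: has_derivative_at_withinI)
  obtain d where d: "d > 0" "\<forall>s\<in>{0..1}. dist s 0 < d \<longrightarrow> \<gamma> s \<in> fst c"
    using curve_near_chart[OF geodesic_continuous[OF \<gamma>] _ c] by auto
  have "((\<lambda>t. f (\<gamma> t)) has_vector_derivative
      mdifferential M f (\<gamma> 0) (velocity M {0..1} \<gamma> 0)) (at 0 within {0..1})"
    by (rule has_vector_derivative_transform_within[OF D d(1)])
       (use d(2) chart_inv_chart[OF c(1)] in auto)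
  then show ?thesis
    by (simp add: has_real_derivative_iff_has_vector_derivative tinner_grad[OF f W])
qed

text \<open>The initial velocity of a minimizing geodesic inside \<open>X\<close> from
  \<open>p\<close> to \<open>q\<close> works: convexity bounds the difference quotients of
  \<open>f\<close> along it by \<open>f q - f p\<close>, and their limit at 0 is the inner product
  with the gradient.\<close>

lemma exists_feasible_velocity_le:
  assumes X: "weakly_geodesically_convex M X" "p \<in> X" "q \<in> X"
    and f: "mdifferentiable_on M f W" "X \<subseteq> W" and reg: "regularity M X f L"
  shows "\<exists>v\<in>feasible_velocities M X p. tinner M p (grad M f p) v \<le> f q - f p"
proof -
  obtain \<gamma> where \<gamma>: "geodesic_on M {0..1} \<gamma>" "\<gamma> 0 = p" "\<gamma> 1 = q"
    "curve_length M \<gamma> = dist p q" "\<gamma> ` {0..1} \<subseteq> X"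
    using X unfolding weakly_geodesically_convex_def by blast
  define v where "v = velocity M {0..1} \<gamma> 0"
  have Exp: "Exp M p (t *\<^sub>R v) = \<gamma> t" if "t \<in> {0..1}" for t
    using Exp_geodesic_scale[OF \<gamma>(1) that] by (simp add: v_def \<gamma>)
  have Exp1: "Exp M p v = q" using Exp[of 1] \<gamma>(3) by simp
  have v: "v \<in> feasible_velocities M X p"
    unfolding feasible_velocities_def
    using X(3) Exp Exp1 geodesic_length[OF \<gamma>(1)] \<gamma> by (auto simp: v_def)
  have conv: "f (\<gamma> t) \<le> (1 - t) * f p + t * f q" if "t \<in> {0..1}" for t
    using reg v X(2) that Exp[OF that] Exp1 unfolding regularity_def by metis
  have "((\<lambda>t. f (\<gamma> t)) has_real_derivative tinner M p (grad M f p) v) (at 0 within {0..1})"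
    using has_derivative_along_geodesic[OF f(1) \<gamma>(1)] X(2) f(2) \<gamma>(2) by (auto simp: v_def)
  then have "((\<lambda>t. (f (\<gamma> t) - f p) / t) \<longlongrightarrow> tinner M p (grad M f p) v) (at 0 within {0..1})"
    by (simp add: has_field_derivative_iff \<gamma>(2))
  \<comment> \<open>The filter excludes 0, so \<open>t\<close> is positive and the convexity
    inequality may be divided by it.\<close>
  moreover have "\<forall>\<^sub>F t in at 0 within {0..1}. (f (\<gamma> t) - f p) / t \<le> f q - f p"
    unfolding eventually_at_filter
  proof (intro always_eventually allI impI)
    fix t :: real assume "t \<noteq> 0" "t \<in> {0..1}"
    then show "(f (\<gamma> t) - f p) / t \<le> f q - f p" using conv[of t] by (simp add: field_simps)
  qed
  moreover have "at (0::real) within {0..1} \<noteq> bot" by (simp add: trivial_limit_within)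
  ultimately have "tinner M p (grad M f p) v \<le> f q - f p" by (rule tendsto_upperbound)
  then show ?thesis using v by blast
qed

end

end

section \<open>One step of the algorithm\<close>

lemma feasible_norm_bounds:
  assumes "compact X" "p \<in> X" "v \<in> feasible_velocities M X p"
  shows "0 \<le> tnorm M p v" "tnorm M p v \<le> diameter X"
proof -
  have "tnorm M p v = dist p (Exp M p v)" "Exp M p v \<in> X"
    using assms(3) by (auto simp: feasible_velocities_def)
  then show "0 \<le> tnorm M p v" "tnorm M p v \<le> diameter X"
    using diameter_bounded_bound[OF compact_imp_bounded[OF assms(1)] assms(2)] by auto
qed

lemma fw_gap_attained: "v \<in> oracle_set M X f p \<Longrightarrow> fw_gap M X f p = - tinner M p (grad M f p) v"
  unfolding fw_gap_def oracle_set_def by (simp, intro cInf_eq_minimum) auto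

lemma min_value_eq: "q \<in> optimizers X f \<Longrightarrow> min_value X f = f q"
  unfolding min_value_def optimizers_def by (intro cInf_eq_minimum) auto

lemma subopt_nonneg: "q \<in> optimizers X f \<Longrightarrow> p \<in> X \<Longrightarrow> 0 \<le> subopt X f p"
  using min_value_eq[of q X f] by (simp add: subopt_def optimizers_def)

lemma subopt_le_0_imp_optimizer:
  "q \<in> optimizers X f \<Longrightarrow> p \<in> X \<Longrightarrow> subopt X f p \<le> 0 \<Longrightarrow> p \<in> optimizers X f"
  using min_value_eq[of q X f] by (force simp: subopt_def optimizers_def)

lemma subopt_descent:
  assumes "regularity M X f L" "p \<in> X" "v \<in> oracle_set M X f p" "t \<in> {0..1}"
  shows "subopt X f (Exp M p (t *\<^sub>R v))
    \<le> subopt X f p - t * fw_gap M X f p + L / 2 * t\<^sup>2 * (tnorm M p v)\<^sup>2"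
proof -
  have "v \<in> feasible_velocities M X p" using assms(3) by (simp add: oracle_set_def)
  then have "f (Exp M p (t *\<^sub>R v))
      \<le> f p + t * tinner M p (grad M f p) v + L / 2 * t\<^sup>2 * (tnorm M p v)\<^sup>2"
    using assms(1,2,4) unfolding regularity_def by blast
  then show ?thesis by (simp add: subopt_def fw_gap_attained[OF assms(3)])
qed

lemma subopt_le_fw_gap:
  assumes "smooth_atlas M" "smooth_metric M" "weakly_geodesically_convex M X"
    and "mdifferentiable_on M f W" "X \<subseteq> W" "regularity M X f L"
    and q: "q \<in> optimizers X f" and p: "p \<in> X" and v: "v \<in> oracle_set M X f p"
  shows "subopt X f p \<le> fw_gap M X f p"
proof -
  have "q \<in> X" using q by (simp add: optimizers_def)
  then obtain w where "w \<in> feasible_velocities M X p" "tinner M p (grad M f p) w \<le> f q - f p"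
    using exists_feasible_velocity_le[OF assms(1-3) p _ assms(4-6)] by blast
  then have "tinner M p (grad M f p) v \<le> f q - f p" using v by (fastforce simp: oracle_set_def)
  then show ?thesis using min_value_eq[OF q] by (simp add: fw_gap_attained[OF v] subopt_def)
qed

text \<open>The error bound turns the ratio \<open>h / r\<close> in the scaling condition into at
  least \<open>h powr (1 - \<theta>) / c\<close>. Multiplying by the maximal oracle length, which
  dominates the norm of the chosen \<open>v\<close>, gives the estimate.\<close>

lemma fw_gap_scaling:
  assumes X: "compact X" and eb: "hoelder_error_bound X f c \<theta> R" "c > 0"
    and sc: "directional_scaling M X f \<sigma> R'" "\<sigma> > 0"
    and p: "p \<in> X" "dist_opt X f p \<le> R" "dist_opt X f p \<le> R'"
    and pos: "subopt X f p > 0" "dist_opt X f p > 0" "p \<notin> optimizers X f"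
    and v: "v \<in> oracle_set M X f p"
  shows "\<sigma> * tnorm M p v * subopt X f p powr (1 - \<theta>) / c \<le> fw_gap M X f p"
proof -
  let ?h = "subopt X f p" and ?r = "dist_opt X f p" and ?m = "max_step_length M X f p"
  have bounds: "0 \<le> tnorm M p w" "tnorm M p w \<le> diameter X" if "w \<in> oracle_set M X f p" for w
    using feasible_norm_bounds[OF X p(1)] that by (auto simp: oracle_set_def)
  have m: "tnorm M p v \<le> ?m"
    unfolding max_step_length_def using bounds v by (intro cSUP_upper bdd_aboveI2) auto
  have g: "\<sigma> * ?h / ?r \<le> fw_gap M X f p / ?m"
    using sc p pos unfolding directional_scaling_def by blast
  have "0 < \<sigma> * ?h / ?r" using sc pos by simp
  \<comment> \<open>Division by zero yields 0 in HOL, so a zero maximal length would contradict the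
    positive lower bound.\<close>
  with g have "?m \<noteq> 0" by auto
  then have m0: "?m > 0" using m bounds(1)[OF v] by linarith
  have "?r \<le> c * ?h powr \<theta>" using eb(1) p unfolding hoelder_error_bound_def by blast
  then have "?h / (c * ?h powr \<theta>) \<le> ?h / ?r"
    using pos eb(2) by (intro divide_left_mono) auto
  moreover have "?h / (c * ?h powr \<theta>) = ?h powr (1 - \<theta>) / c"
    using pos by (simp add: powr_diff)
  ultimately have "\<sigma> * tnorm M p v * (?h powr (1 - \<theta>) / c) \<le> \<sigma> * ?m * (?h / ?r)"
    using sc(2) m m0 bounds(1)[OF v] eb(2) by (intro mult_mono) auto
  also have "\<dots> = (\<sigma> * ?h / ?r) * ?m" by simp
  also have "\<dots> \<le> (fw_gap M X f p / ?m) * ?m" using g m0 by (intro mult_right_mono) auto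
  finally show ?thesis using m0 by simp
qed

theorem theorem4p4:
  fixes M :: "('m::metric_space, 'n::finite) riem"
    and X W E :: "'m set" and f :: "'m \<Rightarrow> real"
    and a L c \<theta> \<sigma> R\<^sub>H R\<^sub>S R \<delta> D :: real
    and x :: "nat \<Rightarrow> 'm" and v :: "nat \<Rightarrow> real ^ 'n" and N :: enat
  assumes manifold: "complete_riemannian_manifold M"
    and X: "compact X" "X \<noteq> {}" "weakly_geodesically_convex M X"
    and D: "D = diameter X" "D > 0"
    and f: "open W" "X \<subseteq> W" "mdifferentiable_on M f W"
    and a: "a > 2"
    and reg: "L > 0" "regularity M X f L"
    and error_bound: "c > 0" "0 < \<theta>" "\<theta> \<le> 1/2" "R\<^sub>H > 0" "hoelder_error_bound X f c \<theta> R\<^sub>H"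
    and scaling: "\<sigma> > 0" "R\<^sub>S > 0" "directional_scaling M X f \<sigma> R\<^sub>S"
    and R: "R = min R\<^sub>H R\<^sub>S"
    and E: "E = {y \<in> X. dist_opt X f y \<ge> R}"
    and \<delta>: "\<delta> = (INF y\<in>E. subopt X f y)"
    and run: "rfw_ol_run M X f a x v N"
  shows "(E \<noteq> {} \<longrightarrow> (\<exists>y\<in>E. subopt X f y = \<delta>) \<and> \<delta> > 0) \<and>
    ((\<exists>K. N = enat K \<and> x K \<in> optimizers X f) \<or>
     (N = \<infinity> \<and> (\<lambda>k. subopt X f (x k)) \<in> O(\<lambda>k. real k powr (- 1 / (1 - \<theta>))))) \<and>
    (\<forall>S::nat. S \<ge> 1 \<and> (E \<noteq> {} \<longrightarrow> a\<^sup>2 * L * D\<^sup>2 / (2 * (real S + a - 1)) < \<delta>) \<and> (E = {} \<longrightarrow> S = 1) \<longrightarrow>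
      (\<forall>k\<ge>S. enat k \<le> N \<longrightarrow>
        subopt X f (x k) \<le>
          max ((open_loop_step a (int k - 2) / open_loop_step a (int S - 1)) powr (1 / (1 - \<theta>))
                 * subopt X f (x S))
              ((open_loop_step a (int k - 2) * (a * c * L * D / (2 * (a - 2) * \<sigma>))) powr (1 / (1 - \<theta>))
                 + L * D\<^sup>2 / 2 * (open_loop_step a (int k - 2))\<^sup>2)))"
proof -

  \<comment> \<open>Constants, existence of optimizers and positive distance from them\<close>
  have atlas: "smooth_atlas M" and metric: "smooth_metric M"
    using manifold by (auto simp: complete_riemannian_manifold_def)
  let ?h = "\<lambda>k. subopt X f (x k)" and ?e = "\<lambda>i. open_loop_step a i" and ?p = "1 / (1 - \<theta>)"
  let ?l = "\<lambda>k. tnorm M (x k) (v k)" and ?g = "\<lambda>k. fw_gap M X f (x k)"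
  \<comment> \<open>Chosen so that, once \<open>h powr (1 - \<theta>) \<ge> A * \<eta>\<close>, the
    fraction \<open>(a - 2) / a\<close> of the first-order decrease \<open>\<eta> * g\<close> pays
    for the quadratic term of the descent inequality.\<close>
  define A where "A = a * c * L * D / (2 * (a - 2) * \<sigma>)"
  define B where "B = L * D\<^sup>2 / 2"
  have AB: "A > 0" "B > 0" using a reg error_bound scaling D by (auto simp: A_def B_def)
  have cont: "continuous_on X f"
    using mdifferentiable_continuous_on[OF atlas f(3)] f(2) continuous_on_subset by blast
  obtain q where "q \<in> X" "\<forall>p\<in>X. f q \<le> f p"
    using continuous_attains_inf[OF X(1,2) cont] by blast
  then have q: "q \<in> optimizers X f" by (simp add: optimizers_def)
  note nonneg = subopt_nonneg[OF q]
  have "optimizers X f = {p \<in> X. f p = f q}" using q by (force simp: optimizers_def)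
  then have closed: "closed (optimizers X f)"
    using continuous_closed_preimage_constant[OF cont compact_imp_closed[OF X(1)]] by simp
  have R0: "R > 0" using R error_bound scaling by simp
  have dist_pos: "dist_opt X f p > 0" if "p \<notin> optimizers X f" for p
    unfolding dist_opt_def using infdist_pos_not_in_closed[OF closed _ that] q by blast

  \<comment> \<open>Attainment and positivity of the minimum over \<open>E\<close>\<close>
  have \<delta>E: "(\<exists>y\<in>E. subopt X f y = \<delta>) \<and> \<delta> > 0" if E0: "E \<noteq> {}"
  proof -
    have "E = X \<inter> {y. R \<le> dist_opt X f y}" by (auto simp: E)
    moreover have "closed {y. R \<le> dist_opt X f y}"
      unfolding dist_opt_def by (intro closed_Collect_le continuous_intros)
    ultimately have "compact E" using X(1) by (simp add: compact_Int_closed)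
    moreover have "continuous_on E (subopt X f)"
      unfolding subopt_def using cont by (intro continuous_intros) (auto simp: E elim: continuous_on_subset)
    ultimately obtain y where y: "y \<in> E" "\<forall>z\<in>E. subopt X f y \<le> subopt X f z"
      using continuous_attains_inf[OF _ E0] by blast
    have "\<delta> = subopt X f y" unfolding \<delta> using y by (intro cInf_eq_minimum) auto
    moreover have "y \<notin> optimizers X f" using y(1) R0 by (auto simp: E dist_opt_def)
    then have "subopt X f y > 0" using subopt_le_0_imp_optimizer[OF q] y(1) by (force simp: E)
    ultimately show ?thesis using y(1) by blast
  qed

  \<comment> \<open>Feasibility and descent along the run\<close>
  have vS: "v k \<in> oracle_set M X f (x k)" if "enat k \<le> N" for k
    using run that by (simp add: rfw_ol_run_def)
  have gap_iff: "?g k = 0 \<longleftrightarrow> N = enat k" if "enat k \<le> N" for k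
    using run that fw_gap_attained[OF vS[OF that]] by (simp add: rfw_ol_run_def Let_def)
  have e01: "0 < ?e (int k)" "?e (int k) \<le> 1" for k using a by (auto simp: open_loop_step_def)
  have iter: "x (Suc k) = Exp M (x k) (?e (int k) *\<^sub>R v k)" "enat k \<le> N" if "enat (Suc k) \<le> N" for k
  proof -
    \<comment> \<open>A generated successor means that the run did not stop at \<open>k\<close>, so
      the gap there is nonzero and the update rule applies.\<close>
    have "enat k < N" using that Suc_ile_eq by blast
    then show "enat k \<le> N" "x (Suc k) = Exp M (x k) (?e (int k) *\<^sub>R v k)"
      using run by (auto simp: rfw_ol_run_def Let_def)
  qed
  have xX: "x k \<in> X" if "enat k \<le> N" for k
    using that
  proof (induction k)
    case 0
    then show ?case using run by (simp add: rfw_ol_run_def)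
  next
    case (Suc k)
    have "v k \<in> feasible_velocities M X (x k)" using vS[OF iter(2)[OF Suc.prems]] by (simp add: oracle_set_def)
    then show ?case
      unfolding iter(1)[OF Suc.prems] feasible_velocities_def using e01[of k] by auto
  qed
  have gap: "?h k \<le> ?g k" if "enat k \<le> N" for k
    by (rule subopt_le_fw_gap[OF atlas metric X(3) f(3,2) reg(2) q xX[OF that] vS[OF that]])
  have len: "0 \<le> ?l k" "?l k \<le> D" if "enat k \<le> N" for k
    using feasible_norm_bounds[OF X(1) xX[OF that], of "v k" M] vS[OF that] D(1)
    by (auto simp: oracle_set_def)
  have descent: "?h (Suc k) \<le> ?h k - ?e (int k) * ?g k + L / 2 * (?e (int k))\<^sup>2 * (?l k)\<^sup>2"
    if "enat (Suc k) \<le> N" for k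
    unfolding iter(1)[OF that]
    by (rule subopt_descent[OF reg(2) xX[OF iter(2)[OF that]] vS[OF iter(2)[OF that]]])
       (use e01[of k] in auto)
  have quad: "L / 2 * (?e (int k))\<^sup>2 * (?l k)\<^sup>2 \<le> B * (?e (int k))\<^sup>2" if "enat k \<le> N" for k
  proof -
    have "(?l k)\<^sup>2 \<le> D\<^sup>2" using len[OF that] by (intro power_mono)
    then have "L / 2 * (?e (int k))\<^sup>2 * (?l k)\<^sup>2 \<le> L / 2 * (?e (int k))\<^sup>2 * D\<^sup>2"
      using reg(1) by (intro mult_left_mono) auto
    then show ?thesis by (simp add: B_def mult_ac)
  qed

  \<comment> \<open>The a priori rate of order 1/k\<close>
  have sublinear: "?h k \<le> a\<^sup>2 * B / (real k + a - 1)" if "1 \<le> k" "enat k \<le> N" for k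
  proof (rule open_loop_sublinear[OF a _ that(1)])
    fix j assume "j < k"
    then have j: "enat (Suc j) \<le> N" using that(2) by (meson Suc_leI enat_ord_simps(1) order_trans)
    have "?e (int j) * ?h j \<le> ?e (int j) * ?g j"
      using gap[OF iter(2)[OF j]] e01[of j] by (intro mult_left_mono) auto
    then show "?h (Suc j) \<le> (1 - ?e (int j)) * ?h j + B * (?e (int j))\<^sup>2"
      using descent[OF j] quad[OF iter(2)[OF j]] by (simp add: algebra_simps)
  qed (use AB in simp)

  \<comment> \<open>The accelerated bound from index \<open>S\<close> on\<close>
  have bound: "?h k \<le> max ((?e (int k - 2) / ?e (int S - 1)) powr ?p * ?h S)
      ((?e (int k - 2) * A) powr ?p + B * (?e (int k - 2))\<^sup>2)"
    if S: "S \<ge> 1" "E \<noteq> {} \<Longrightarrow> a\<^sup>2 * L * D\<^sup>2 / (2 * (real S + a - 1)) < \<delta>"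
      and k: "S \<le> k" "enat k \<le> N" for S k
  proof -
    \<comment> \<open>An iterate farther away than \<open>R\<close> would lie in \<open>E\<close>
      and have suboptimality at least \<delta>, whereas the a priori rate is below \<delta> from
      index \<open>S\<close> on.\<close>
    have near: "dist_opt X f (x j) \<le> R" if j: "S \<le> j" "enat j \<le> N" for j
    proof (rule ccontr)
      assume "\<not> dist_opt X f (x j) \<le> R"
      then have "x j \<in> E" using xX[OF j(2)] by (simp add: E)
      then have "E \<noteq> {}" by blast
      have "?h j \<le> a\<^sup>2 * B / (real j + a - 1)" using S j by (intro sublinear) auto
      also have "\<dots> \<le> a\<^sup>2 * B / (real S + a - 1)"
        using S j a AB by (intro divide_left_mono mult_pos_pos) auto
      also have "\<dots> = a\<^sup>2 * L * D\<^sup>2 / (2 * (real S + a - 1))" by (simp add: B_def)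
      also have "\<dots> < \<delta>" using S(2) \<open>E \<noteq> {}\<close> .
      also have "\<delta> \<le> ?h j" unfolding \<delta>
        using \<open>x j \<in> E\<close> nonneg by (intro cINF_lower bdd_belowI2[of _ 0]) (auto simp: E)
      finally show False by simp
    qed
    have "?h k \<le> max ((?e (int k - 1) / ?e (int S - 1)) powr ?p * ?h S)
      ((?e (int k - 1) * A) powr ?p + B * (?e (int k - 1) * ?e (int k - 2)))"
    proof (rule open_loop_recursion[OF a error_bound(2,3) AB(1) less_imp_le[OF AB(2)] S(1) k(1)])
      fix j assume j: "S \<le> j" "j \<le> k"
      then show "0 \<le> ?h j" using k by (intro nonneg xX) (meson enat_ord_simps(1) order_trans)
    next
      fix j assume j: "S \<le> j" "j < k"
      then have Sj: "enat (Suc j) \<le> N" using k(2) by (meson Suc_leI enat_ord_simps(1) order_trans)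
      note jN = iter(2)[OF Sj]
      have "0 \<le> ?e (int j) * ?g j"
        using order_trans[OF nonneg[OF xX[OF jN]] gap[OF jN]] e01(1)[of j] by simp
      then show "?h (Suc j) \<le> ?h j + B * (?e (int j))\<^sup>2"
        using descent[OF Sj] quad[OF jN] by linarith
      assume big: "A * ?e (int j) \<le> ?h j powr (1 - \<theta>)"
      define \<eta> where "\<eta> = ?e (int j)"
      have \<eta>: "\<eta> > 0" using e01(1) by (simp add: \<eta>_def)
      \<comment> \<open>In HOL \<open>0 powr (1 - \<theta>) = 0\<close>, which would contradict the
        positive lower bound \<open>A * \<eta>\<close>.\<close>
      have "?h j \<noteq> 0" using big AB(1) \<eta> by (auto simp: \<eta>_def mult_le_0_iff)
      then have pos: "?h j > 0" using nonneg[OF xX[OF jN]] by simp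
      then have "x j \<notin> optimizers X f" using min_value_eq[of "x j" X f] by (auto simp: subopt_def)
      then have "\<sigma> * ?l j * ?h j powr (1 - \<theta>) / c \<le> ?g j"
        using near[OF j(1) jN] R pos dist_pos
        by (intro fw_gap_scaling[OF X(1) error_bound(5,1) scaling(3,1) xX[OF jN] _ _ _ _ _ vS[OF jN]])
           auto
      moreover have "\<sigma> * ?l j * (A * \<eta>) / c \<le> \<sigma> * ?l j * ?h j powr (1 - \<theta>) / c"
        using big len[OF jN] scaling(1) error_bound(1) by (intro divide_right_mono mult_left_mono) (auto simp: \<eta>_def)
      ultimately have g: "\<sigma> * ?l j * (A * \<eta>) / c \<le> ?g j" by linarith
      \<comment> \<open>Only one factor \<open>?l j\<close> is replaced by \<open>D\<close>: the
        lower bound on the gap is linear in \<open>?l j\<close>, and the remaining factor matches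
        it.\<close>
      have "L / 2 * \<eta>\<^sup>2 * (?l j)\<^sup>2 \<le> L / 2 * \<eta>\<^sup>2 * (?l j * D)"
        unfolding power2_eq_square[of "?l j"] using len[OF jN] reg(1) by (intro mult_left_mono) auto
      also have "\<dots> = \<eta> * ((a - 2) / a) * (\<sigma> * ?l j * (A * \<eta>) / c)"
        using a scaling(1) error_bound(1) by (simp add: A_def field_simps power2_eq_square)
      also have "\<dots> \<le> \<eta> * ((a - 2) / a) * ?g j" using g a \<eta> by (intro mult_left_mono) auto
      finally have 1: "L / 2 * \<eta>\<^sup>2 * (?l j)\<^sup>2 \<le> \<eta> * ((a - 2) / a) * ?g j" .
      have 2: "\<eta> * (2 / a) * ?h j \<le> \<eta> * (2 / a) * ?g j"
        using gap[OF jN] \<eta> a by (intro mult_left_mono) auto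
      have "\<eta> * ((a - 2) / a) * ?g j + \<eta> * (2 / a) * ?g j = \<eta> * ?g j"
        using a by (simp add: field_simps)
      then have "?h (Suc j) \<le> ?h j - \<eta> * (2 / a) * ?h j"
        using descent[OF Sj, folded \<eta>_def] 1 2 by linarith
      also have "\<eta> * (2 / a) = 2 / (real j + a)" using a by (simp add: \<eta>_def open_loop_step_def)
      finally show "?h (Suc j) \<le> (1 - 2 / (real j + a)) * ?h j" by (simp add: left_diff_distrib)
    qed
    also have "\<dots> \<le> max ((?e (int k - 2) / ?e (int S - 1)) powr ?p * ?h S)
      ((?e (int k - 2) * A) powr ?p + B * (?e (int k - 2))\<^sup>2)"
    proof -
      \<comment> \<open>The recursion is sharper by one index. The steps decrease, so the index may
        be lowered to \<open>k - 2\<close>; for \<open>k = 1\<close> this is the step of index -1,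
        whose denominator \<open>a - 1\<close> is still positive.\<close>
      have "real k \<ge> 1" using S k by linarith
      then have e: "0 < ?e (int k - 1)" "?e (int k - 1) \<le> ?e (int k - 2)" "0 < ?e (int S - 1)"
        using a S by (auto simp: open_loop_step_def intro!: divide_left_mono)
      have "0 \<le> ?h S" using S k by (intro nonneg xX) (meson enat_ord_simps(1) order_trans)
      then show ?thesis
        unfolding power2_eq_square using e AB error_bound(3)
        by (intro max.mono add_mono mult_right_mono mult_left_mono powr_mono2 divide_right_mono) auto
    qed
    finally show ?thesis .
  qed

  \<comment> \<open>The asymptotic rate\<close>
  have rate: "?h \<in> O(\<lambda>k. real k powr (- 1 / (1 - \<theta>)))" if N: "N = \<infinity>"
  proof -
    obtain S :: nat where S: "S \<ge> 1" "E \<noteq> {} \<Longrightarrow> a\<^sup>2 * L * D\<^sup>2 / (2 * (real S + a - 1)) < \<delta>"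
    proof (cases "E = {}")
      case False
      obtain n where n: "a\<^sup>2 * L * D\<^sup>2 / (2 * \<delta>) < real n" using reals_Archimedean2 by blast
      have "a\<^sup>2 * L * D\<^sup>2 / (2 * \<delta>) < real (Suc n) + a - 1" using n a by simp
      then have "a\<^sup>2 * L * D\<^sup>2 / (2 * (real (Suc n) + a - 1)) < \<delta>"
        using a \<delta>E[OF False] by (simp add: field_simps)
      then show ?thesis using that[of "Suc n"] by simp
    qed (use that[of 1] in simp)
    have hS: "0 \<le> ?h S" using nonneg xX N by simp
    have p: "0 < ?p" "?p \<le> 2" using error_bound by (auto simp: field_simps)
    \<comment> \<open>Bounds the maximum by the sum of its terms, using
      \<open>?e (int k - 2) \<le> a / real k\<close>, which holds since \<open>a > 2\<close>. The
      squared step is of order \<open>1 / real k\<close> to the power 2, which is at most its power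
      \<open>?p\<close> because \<open>?p \<le> 2\<close>.\<close>
    define C where "C = (a / ?e (int S - 1)) powr ?p * ?h S + (a * A) powr ?p + B * a\<^sup>2"
    have "?h k \<le> C * real k powr (- 1 / (1 - \<theta>))" if k: "k \<ge> S" for k
    proof -
      have k1: "real k \<ge> 1" using S k by linarith
      have eS: "0 < ?e (int S - 1)" using a S by (simp add: open_loop_step_def)
      have e: "0 < ?e (int k - 2)" "?e (int k - 2) \<le> a / real k"
        using a k1 by (auto simp: open_loop_step_def intro!: divide_left_mono)
      have K: "real k powr (- 1 / (1 - \<theta>)) = (1 / real k) powr ?p"
        using k1 by (simp add: powr_divide powr_minus_divide)
      have "(?e (int k - 2) / ?e (int S - 1)) powr ?p \<le> (a / ?e (int S - 1) * (1 / real k)) powr ?p"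
        using divide_right_mono[OF e(2), of "?e (int S - 1)"] e eS p
        by (intro powr_mono2) (auto simp: mult.commute)
      also have "\<dots> = (a / ?e (int S - 1)) powr ?p * (1 / real k) powr ?p"
        using a eS k1 by (intro powr_mult)
      finally have 1: "(?e (int k - 2) / ?e (int S - 1)) powr ?p * ?h S
        \<le> (a / ?e (int S - 1)) powr ?p * (1 / real k) powr ?p * ?h S"
        using hS by (rule mult_right_mono)
      have "(?e (int k - 2) * A) powr ?p \<le> (a * A * (1 / real k)) powr ?p"
        using mult_right_mono[OF e(2), of A] e AB p by (intro powr_mono2) (auto simp: mult.commute)
      also have "\<dots> = (a * A) powr ?p * (1 / real k) powr ?p"
        using a AB k1 by (intro powr_mult)
      finally have 2: "(?e (int k - 2) * A) powr ?p \<le> (a * A) powr ?p * (1 / real k) powr ?p" .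
      have "(?e (int k - 2))\<^sup>2 \<le> (a / real k)\<^sup>2" using e by (intro power_mono) auto
      also have "\<dots> = a\<^sup>2 * (1 / real k) powr 2" using k1 by (simp add: power_divide)
      also have "\<dots> \<le> a\<^sup>2 * (1 / real k) powr ?p"
        using k1 p by (intro mult_left_mono powr_mono') auto
      finally have 3: "B * (?e (int k - 2))\<^sup>2 \<le> B * (a\<^sup>2 * (1 / real k) powr ?p)"
        using AB by (intro mult_left_mono) auto
      have "?h k \<le> max ((?e (int k - 2) / ?e (int S - 1)) powr ?p * ?h S)
        ((?e (int k - 2) * A) powr ?p + B * (?e (int k - 2))\<^sup>2)"
        using bound[OF S k] N by simp
      also have "\<dots> \<le> (?e (int k - 2) / ?e (int S - 1)) powr ?p * ?h S
        + ((?e (int k - 2) * A) powr ?p + B * (?e (int k - 2))\<^sup>2)"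
        using hS AB by simp
      also have "\<dots> \<le> C * (1 / real k) powr ?p"
        using 1 2 3 unfolding C_def by (simp add: algebra_simps)
      finally show ?thesis by (simp only: K)
    qed
    then have "\<forall>\<^sub>F k in sequentially. norm (?h k) \<le> C * norm (real k powr (- 1 / (1 - \<theta>)))"
      using nonneg xX N unfolding eventually_sequentially by auto
    then show ?thesis by (rule bigoI)
  qed

  \<comment> \<open>The two possible outcomes of a run\<close>
  have outcome: "(\<exists>K. N = enat K \<and> x K \<in> optimizers X f) \<or>
     (N = \<infinity> \<and> ?h \<in> O(\<lambda>k. real k powr (- 1 / (1 - \<theta>))))"
  proof (cases N)
    case (enat K)
    then have "?h K \<le> 0" using gap[of K] gap_iff[of K] by simp
    then show ?thesis using enat subopt_le_0_imp_optimizer[OF q xX] by simp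
  qed (use rate in simp)
  show ?thesis
    using \<delta>E outcome bound unfolding A_def B_def by blast
qed

end
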